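(* Let $k$ be an algebraically closed field of characteristic $p>2$, and let $A$ be a discrete valuation ring containing its residue field $k$, with uniformizer $t$. Let $e_1,\dots,e_n$ be positive integers, all less than $p$, and $d$ an integer with $\sum_i (e_i-1)=2d-2$. Let $f_t$ be a family of maps of degree $d$ from $\mathbb P^1$ to $\mathbb P^1$ over $\mathrm{Spec}\,A$ (more precisely, a linear series of degree $d$ and dimension $1$ on $\mathbb P^1_A$) whose generic fiber is (separable and) tamely ramified, with ramification index $e_i$ along sections $P_i$ of $\mathbb P^1_A$, and whose special fiber is inseparable. Assume further that the sections $P_i$ stay away from infinity (i.e. they are sections of $\mathbb A^1_A$). Let $\bar P_i\in\mathbb A^1(k)$ be the limit of $P_i$ in the special fiber. Then: (i) If the $\bar P_i$ are distinct, then for some integer $m$ with $p\le m\le d$ there exists a separable map $\mathbb P^1\to\mathbb P^1$ over $k$ of degree $d+m-1$, ramified to order $e_i$ at $\bar P_i$ for each $i$, and to order $2m-1$ at infinity. (ii) If $\bar P_j=\bar P_{j'}$ for some $j\ne j'$ with $e_j+e_{j'}<p$, and the $\bar P_i$ are otherwise distinct, then for some integer $m$ with $p\le m\le d$ and some integer $b$ with $0\le b<(e_j+e_{j'}-1)/2$ there exists a separable map $\mathbb P^1\to\mathbb P^1$ over $k$ of degree $d+m-1-b$, ramified to order $e_i$ at $\bar P_i$ for each $i\ne j,j'$, to order $e_j+e_{j'}-2b-1$ at $\bar P_j=\bar P_{j'}$, and to order $2m-1$ at infinity.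
   Context: A linear series of degree $d$ and dimension $1$ on $\mathbb P^1_A$ is a rank-$2$ free submodule $V\subset H^0(\mathbb P^1_A,\mathcal O(d))$ with $V\otimes_A k\to H^0(\mathbb P^1_k,\mathcal O(d))$ injective; concretely it is given by a pair of polynomials $F,G\in A[x]$ of degree at most $d$ that are linearly independent modulo $t$. The generic fiber is a base-point-free linear series over $K=\mathrm{Frac}(A)$, corresponding to a degree-$d$ map modulo automorphism of the image; since $\sum_i(e_i-1)=2d-2$ it is unramified away from the $P_i$. The special fiber may have base points; it is called inseparable if the map to $\mathbb P^1_k$ obtained after removing base points is inseparable. "Ramified to order $e$ at $P$" means the ramification index at $P$ is $e$ (order $1$ meaning unramified). *)

theory Defs
  imports
    "HOL-Algebra.Algebraic_Closure_Type"
    "HOL-Computational_Algebra.Computational_Algebra"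
begin

section \<open>Discrete valuation rings containing their residue field\<close>

definition uniformizer :: "'a :: idom \<Rightarrow> bool" where
  "uniformizer t \<longleftrightarrow>
     Factorial_Ring.irreducible t \<and> (\<forall>a. a \<noteq> 0 \<longrightarrow> (\<exists>u n. u dvd 1 \<and> a = u * t ^ n))"

definition unital_ring_hom :: "('a :: comm_ring_1 \<Rightarrow> 'b :: comm_ring_1) \<Rightarrow> bool" where
  "unital_ring_hom h \<longleftrightarrow>
     h 1 = 1 \<and> (\<forall>a b. h (a + b) = h a + h b) \<and> (\<forall>a b. h (a * b) = h a * h b)"

text \<open>
  The ring is the whole type \<open>'a\<close>: it is a discrete valuation ring because it has a uniformizer
  \<open>t\<close>. The homomorphism \<open>\<rho>\<close> has kernel \<open>(t)\<close> and is onto (it has the section \<open>\<iota>\<close>), so it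
  identifies \<open>'k\<close> with the residue field; \<open>\<iota>\<close> is the inclusion of the residue field in the ring.
\<close>
definition dvr_with_residue_field ::
    "'a :: idom \<Rightarrow> ('k :: field \<Rightarrow> 'a) \<Rightarrow> ('a \<Rightarrow> 'k) \<Rightarrow> bool" where
  "dvr_with_residue_field t \<iota> \<rho> \<longleftrightarrow>
     uniformizer t \<and> unital_ring_hom \<iota> \<and> unital_ring_hom \<rho> \<and>
     (\<forall>a. \<rho> a = 0 \<longleftrightarrow> t dvd a) \<and> (\<forall>c. \<rho> (\<iota> c) = c)"

section \<open>Maps from the projective line to itself\<close>

datatype 'f proj_line = Fin 'f | Infty

text \<open>
  A pair \<open>(F, G)\<close> of polynomials of degree at most \<open>d\<close> stands for two sections of \<open>O(d)\<close> on the
  projective line. In the coordinate \<open>1/x\<close> at infinity, the section \<open>F\<close> is the polynomial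
  \<open>x\<^sup>d F(1/x)\<close>; in particular its value at infinity is \<open>coeff F d\<close>. The pair defines a map of
  degree \<open>d\<close>, \<open>x \<mapsto> [F(x) : G(x)]\<close>, iff the sections have no common zero on the projective line.
\<close>
definition at_infinity :: "nat \<Rightarrow> 'f :: field poly \<Rightarrow> 'f poly" where
  "at_infinity d F = (\<Sum>i\<le>d. Polynomial.monom (Polynomial.coeff F i) (d - i))"

definition p1_map :: "nat \<Rightarrow> 'f :: field poly \<Rightarrow> 'f poly \<Rightarrow> bool" where
  "p1_map d F G \<longleftrightarrow>
     Polynomial.degree F \<le> d \<and> Polynomial.degree G \<le> d \<and>
     coprime F G \<and> (Polynomial.coeff F d \<noteq> 0 \<or> Polynomial.coeff G d \<noteq> 0)"

text \<open>
  The ramification index of the map \<open>[F : G]\<close> of degree \<open>d\<close> at a point \<open>Q\<close> is the order of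
  vanishing at \<open>Q\<close> of \<open>G(Q) F - F(Q) G\<close>, whose divisor is the fibre through \<open>Q\<close>. It is meaningful
  only under \<open>p1_map d F G\<close> and for a nonconstant map.
\<close>
fun ram_index :: "nat \<Rightarrow> 'f :: field poly \<Rightarrow> 'f poly \<Rightarrow> 'f proj_line \<Rightarrow> nat" where
  "ram_index d F G (Fin c) =
     Polynomial.order c (Polynomial.smult (poly G c) F - Polynomial.smult (poly F c) G)"
| "ram_index d F G Infty =
     (let F' = at_infinity d F; G' = at_infinity d G
      in Polynomial.order 0 (Polynomial.smult (poly G' 0) F' - Polynomial.smult (poly F' 0) G'))"

text \<open>Tameness is tested at all geometric points.\<close>
definition tamely_ramified :: "nat \<Rightarrow> 'f :: field poly \<Rightarrow> 'f poly \<Rightarrow> bool" where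
  "tamely_ramified d F G \<longleftrightarrow>
     (\<forall>Q :: 'f alg_closure proj_line.
        \<not> CHAR('f) dvd ram_index d (map_poly to_ac F) (map_poly to_ac G) Q)"

section \<open>Separability\<close>

definition const_fract :: "'f :: field \<Rightarrow> 'f poly fract" where
  "const_fract c = to_fract [:c:]"

text \<open>The subfield \<open>K(f)\<close> of \<open>K(x)\<close>.\<close>
definition subfield_gen :: "'f :: field poly fract \<Rightarrow> 'f poly fract set" where
  "subfield_gen f =
     {poly (map_poly const_fract P) f / poly (map_poly const_fract Q) f | P Q. True}"

definition separable_over :: "'g :: field set \<Rightarrow> 'g \<Rightarrow> bool" where
  "separable_over L y \<longleftrightarrow>
     (\<exists>P. (\<forall>i. Polynomial.coeff P i \<in> L) \<and> coprime P (pderiv P) \<and> poly P y = 0)"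

text \<open>
  The map \<open>[F : G]\<close> corresponds to the inclusion of function fields \<open>K(f) \<subseteq> K(x)\<close> with
  \<open>f = F/G\<close>, and is separable iff this field extension is. Common factors of \<open>F\<close> and \<open>G\<close>, i.e.
  base points, cancel in \<open>F/G\<close>, so for a pair with base points this is separability of the map
  obtained by removing them.
\<close>
definition separable_map :: "'f :: field poly \<Rightarrow> 'f poly \<Rightarrow> bool" where
  "separable_map F G \<longleftrightarrow> (\<forall>y. separable_over (subfield_gen (to_fract F / to_fract G)) y)"

section \<open>Linear series over a discrete valuation ring\<close>

definition linear_series ::
    "('a :: idom \<Rightarrow> 'k :: field) \<Rightarrow> nat \<Rightarrow> 'a poly \<Rightarrow> 'a poly \<Rightarrow> bool" where
  "linear_series \<rho> d F G \<longleftrightarrow>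
     Polynomial.degree F \<le> d \<and> Polynomial.degree G \<le> d \<and>
     (\<forall>a b. Polynomial.smult a (map_poly \<rho> F) + Polynomial.smult b (map_poly \<rho> G) = 0
            \<longrightarrow> a = 0 \<and> b = 0)"

end

theory Submission
  imports Defs
begin

text \<open>
  Write \<open>W = F' G - F G'\<close>. On the generic fibre a degree count gives
  \<open>W = w \<Prod>\<^sub>i (x - P\<^sub>i)\<^bsup>e\<^sub>i - 1\<^esup>\<close> with a scalar \<open>w\<close>, whereas \<open>W\<close> vanishes on the special fibre because of
  inseparability. Polynomials in \<open>x\<^sup>p\<close> are constants of the derivation, so row operations over them
  preserve \<open>W\<close>; combining them with divisions by \<open>t\<close> leads to a pair with \<open>W\<close> nonzero modulo \<open>t\<close>,
  whose reduction \<open>(f, g)\<close> has degrees that differ modulo \<open>p\<close> and Wronskian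
  \<open>c \<Prod>\<^sub>i (x - \<rho> P\<^sub>i)\<^bsup>e\<^sub>i - 1\<^esup>\<close>, whence \<open>deg f + deg g = 2 d - 1\<close>. With \<open>deg g < deg f\<close> put
  \<open>m = d - deg g\<close>. The reductions of \<open>F\<close> and \<open>G\<close> have a combination of degree at most \<open>d - p\<close>, and it
  lies in the module spanned by \<open>f\<close> and \<open>g\<close> over the constants; so \<open>m \<ge> p\<close>. The condition that some
  scalar combination vanishes to order \<open>e\<^sub>i\<close> at \<open>P\<^sub>i\<close> survives all steps and forbids a base point at
  \<open>\<rho> P\<^sub>i\<close>, except where two of the points collide, at which the common factor is divided out.
\<close>

section \<open>Ring homomorphisms and polynomials\<close>

lemma unital_ring_hom_simps:
  fixes h :: "'a :: comm_ring_1 \<Rightarrow> 'b :: comm_ring_1"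
  assumes "unital_ring_hom h"
  shows "h 1 = 1" "h (a + b) = h a + h b" "h (a * b) = h a * h b" "h 0 = 0"
    "h (- a) = - h a" "h (a - b) = h a - h b" "h (a ^ n) = h a ^ n" "h (of_nat n) = of_nat n"
proof -
  show one: "h 1 = 1" and add: "h (a + b) = h a + h b" and mult: "h (a * b) = h a * h b" for a b
    using assms by (auto simp: unital_ring_hom_def)
  show zero: "h 0 = 0" using add[of 0 0] by simp
  show uminus: "h (- a) = - h a" for a using add[of a "- a"] zero by (simp add: eq_neg_iff_add_eq_0 add.commute)
  show "h (a - b) = h a - h b" using add[of a "- b"] uminus by simp
  show "h (a ^ n) = h a ^ n" by (induction n) (auto simp: one mult)
  show "h (of_nat n) = of_nat n" by (induction n) (auto simp: one zero add)
qed

lemma unital_ring_hom_prod: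
  assumes "unital_ring_hom h"
  shows "h (prod f S) = (\<Prod>i\<in>S. h (f i))"
  by (induction S rule: infinite_finite_induct) (auto simp: unital_ring_hom_simps[OF assms])

lemma unital_ring_hom_map_poly:
  fixes h :: "'a :: comm_ring_1 \<Rightarrow> 'b :: comm_ring_1"
  assumes "unital_ring_hom h"
  shows "unital_ring_hom (map_poly h)"
proof -
  note hom = unital_ring_hom_simps[OF assms]
  have sum: "h (sum f S) = (\<Sum>x\<in>S. h (f x))" for f and S :: "nat set"
    by (induction S rule: infinite_finite_induct) (auto simp: hom)
  show ?thesis
    unfolding unital_ring_hom_def
    by (auto intro!: poly_eqI simp: coeff_map_poly hom sum coeff_mult map_poly_1')
qed

lemma map_poly_hom_simps:
  fixes h :: "'a :: comm_ring_1 \<Rightarrow> 'b :: comm_ring_1"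
  assumes "unital_ring_hom h"
  shows "map_poly h (smult c f) = smult (h c) (map_poly h f)"
    "map_poly h (pCons c f) = pCons (h c) (map_poly h f)"
    "map_poly h (monom c n) = monom (h c) n"
    "poly (map_poly h f) (h a) = h (poly f a)"
proof -
  note hom = unital_ring_hom_simps[OF assms]
  show "map_poly h (smult c f) = smult (h c) (map_poly h f)"
    by (intro poly_eqI) (simp add: coeff_map_poly hom)
  show pc: "map_poly h (pCons c f) = pCons (h c) (map_poly h f)" for c f
    by (simp add: map_poly_pCons hom)
  show "map_poly h (monom c n) = monom (h c) n"
    by (intro poly_eqI) (simp add: coeff_map_poly hom)
  show "poly (map_poly h f) (h a) = h (poly f a)"
    by (induction f) (simp_all add: pc hom)
qed

lemma pderiv_map_poly:
  fixes h :: "'a :: idom \<Rightarrow> 'b :: idom"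
  assumes "unital_ring_hom h"
  shows "pderiv (map_poly h f) = map_poly h (pderiv f)"
  by (intro poly_eqI) (simp add: coeff_map_poly unital_ring_hom_simps[OF assms] coeff_pderiv del: of_nat_Suc)

lemma unital_ring_hom_to_fract: "unital_ring_hom to_fract"
  by (simp add: unital_ring_hom_def)

text \<open>The cofactor of the power of \<open>x - a\<close> is nonzero at \<open>a\<close>, and an
  injective \<open>h\<close> keeps it so. This moves vanishing orders between the ring and its
  fraction field.\<close>

lemma order_map_poly:
  fixes h :: "'a :: idom \<Rightarrow> 'b :: idom"
  assumes h: "unital_ring_hom h" and "inj h" and "f \<noteq> 0"
  shows "order (h a) (map_poly h f) = order a f"
proof -
  note hom = unital_ring_hom_simps[OF unital_ring_hom_map_poly[OF h]] map_poly_hom_simps[OF h]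
    unital_ring_hom_simps[OF h]
  obtain q where f: "f = [:-a, 1:] ^ order a f * q" and q: "\<not> [:-a, 1:] dvd q"
    using order_decomp[OF \<open>f \<noteq> 0\<close>] by blast
  have "poly q a \<noteq> 0" using q by (simp add: poly_eq_0_iff_dvd)
  then have "h (poly q a) \<noteq> 0"
    using \<open>inj h\<close> unital_ring_hom_simps(4)[OF h] by (metis injD)
  then have nz: "poly (map_poly h q) (h a) \<noteq> 0" by (simp add: hom)
  have "map_poly h f = [:- h a, 1:] ^ order a f * map_poly h q"
    by (subst f) (simp add: hom)
  moreover have "map_poly h q \<noteq> 0" using nz by auto
  ultimately show ?thesis
    using nz by (simp add: order_mult order_power_n_n order_0I del: mult_pCons_left)
qed

section \<open>Wronskians and ramification\<close>

text \<open>The numerator of the derivative of \<open>f / g\<close>. It detects both ramification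
  and base points, and a scalar change of the pair multiplies it by the determinant.\<close>

definition wronskian :: "'a :: idom poly \<Rightarrow> 'a poly \<Rightarrow> 'a poly" where
  "wronskian f g = pderiv f * g - f * pderiv g"

lemma wronskian_swap: "wronskian g f = - wronskian f g"
  by (simp add: wronskian_def)

lemma wronskian_0 [simp]: "wronskian 0 g = 0" "wronskian f 0 = 0"
  by (simp_all add: wronskian_def)

lemma wronskian_comb:
  "wronskian (smult a f + smult b g) g = smult a (wronskian f g)"
  "wronskian (smult a f - smult b g) g = smult a (wronskian f g)"
  "wronskian f (smult a f + smult b g) = smult b (wronskian f g)"
  "wronskian f (smult a f - smult b g) = - smult b (wronskian f g)"
  by (simp_all add: wronskian_def pderiv_add pderiv_diff pderiv_smult algebra_simps
      smult_add_right smult_diff_right)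

lemma wronskian_smult_right: "wronskian f (smult c g) = smult c (wronskian f g)"
  using wronskian_comb(3)[of f 0 c g] by simp

text \<open>Polynomials with zero derivative act as scalars for the derivation; in characteristic p
  they include all polynomials in \<open>x^p\<close>.\<close>

lemma wronskian_diff_mult: "pderiv q = 0 \<Longrightarrow> wronskian (f - q * g) g = wronskian f g"
  by (simp add: wronskian_def pderiv_diff pderiv_mult algebra_simps)

lemma wronskian_mult: "wronskian (h * f) (h * g) = h ^ 2 * wronskian f g"
  by (simp add: wronskian_def pderiv_mult algebra_simps power2_eq_square)

lemma map_poly_wronskian:
  assumes "unital_ring_hom h"
  shows "map_poly h (wronskian f g) = wronskian (map_poly h f) (map_poly h g)"
  by (simp add: wronskian_def pderiv_map_poly[OF assms]
      unital_ring_hom_simps[OF unital_ring_hom_map_poly[OF assms]])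

lemma coeff_mult_top:
  assumes "degree a \<le> m" "degree b \<le> n"
  shows "coeff (a * b) (m + n) = coeff a m * coeff b n"
proof (cases "degree a = m \<and> degree b = n")
  case True
  then show ?thesis using coeff_mult_degree_sum by metis
next
  case False
  then have "degree a < m \<or> degree b < n" using assms by auto
  moreover have "degree (a * b) < m + n"
    using False assms degree_mult_le[of a b] by linarith
  ultimately show ?thesis by (auto simp: coeff_eq_0)
qed

lemma degree_pderiv_le: "degree (pderiv f) \<le> degree f - 1"
  by (intro degree_le) (auto simp: coeff_pderiv coeff_eq_0)

text \<open>The bounds \<open>m\<close> and \<open>n\<close> may exceed the degrees. For
  \<open>m = n\<close> the top coefficient vanishes, as needed for two sections of
  \<open>O(d)\<close>.\<close>

lemma wronskian_top:
  assumes "degree f \<le> m" "degree g \<le> n" "0 < m + n"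
  shows "coeff (wronskian f g) (m + n - 1) = (of_nat m - of_nat n) * coeff f m * coeff g n"
    and "degree (wronskian f g) \<le> m + n - 1"
proof -
  have p: "coeff (pderiv a * b) (k + l - 1) = of_nat k * coeff a k * coeff b l
       \<and> degree (pderiv a * b) \<le> k + l - 1"
    if "degree a \<le> k" "degree b \<le> l" for a b :: "'a poly" and k l
  proof (cases k)
    case 0
    then have "pderiv a = 0" using that by (metis degree_0_id le_zero_eq pderiv_singleton)
    then show ?thesis using 0 by simp
  next
    case (Suc k')
    have "degree (pderiv a) \<le> k'" using degree_pderiv_le[of a] that(1) Suc by linarith
    then show ?thesis
      using coeff_mult_top[OF _ that(2), of "pderiv a" k'] Suc that(2)
        degree_mult_le[of "pderiv a" b] by (simp add: coeff_pderiv mult_ac)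
  qed
  from p[OF assms(1,2)] p[OF assms(2,1)]
  show "coeff (wronskian f g) (m + n - 1) = (of_nat m - of_nat n) * coeff f m * coeff g n"
    "degree (wronskian f g) \<le> m + n - 1"
    by (simp_all add: wronskian_def algebra_simps degree_diff_le)
qed

text \<open>With \<open>y = (x - c)^(s+1) z\<close> the lowest term of the Wronskian at
  \<open>c\<close> is \<open>(s+1) z(c) g(c) (x - c)^s\<close>; tameness keeps \<open>s + 1\<close>
  nonzero.\<close>

lemma order_wronskian_left:
  fixes y g :: "'a :: idom poly"
  assumes "y \<noteq> 0" "of_nat (order c y) \<noteq> (0 :: 'a)" "poly g c \<noteq> 0"
  shows "wronskian y g \<noteq> 0" "order c (wronskian y g) = order c y - 1"
proof -
  let ?l = "[:-c, 1:]"
  obtain s where s: "order c y = Suc s" using assms(2) by (cases "order c y") auto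
  obtain z where y: "y = ?l ^ Suc s * z" and "\<not> ?l dvd z"
    using order_decomp[OF assms(1), of c] s by auto
  then have z: "poly z c \<noteq> 0" by (simp add: poly_eq_0_iff_dvd)
  define w where "w = smult (of_nat (Suc s)) (z * g) + ?l * (pderiv z * g - z * pderiv g)"
  have "pderiv (?l ^ Suc s) = smult (of_nat (Suc s)) (?l ^ s)"
    by (simp only: pderiv_power_Suc) (simp add: pderiv_pCons)
  then have W: "wronskian y g = ?l ^ s * w"
    unfolding wronskian_def w_def y
    by (simp only: pderiv_mult) (simp add: algebra_simps smult_add_right smult_diff_right)
  have "poly w c \<noteq> 0" using assms(2,3) z s by (simp add: w_def del: of_nat_Suc)
  then have w: "w \<noteq> 0" "order c w = 0" by (auto simp: order_0I)
  have "?l ^ s * w \<noteq> 0" using w by simp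
  then show "wronskian y g \<noteq> 0" "order c (wronskian y g) = order c y - 1"
    using W w s by (simp_all add: order_mult order_power_n_n del: mult_pCons_left)
qed

text \<open>Differentiation lowers a vanishing order by at most one, in any characteristic, and a
  zero of \<open>g\<close> makes up for the loss. The second claim later excludes base
  points.\<close>

lemma power_dvd_wronskian:
  fixes y g :: "'a :: idom poly"
  assumes "[:-c, 1:] ^ r dvd y"
  shows "[:-c, 1:] ^ (r - 1) dvd wronskian y g"
    and "poly g c = 0 \<Longrightarrow> [:-c, 1:] ^ r dvd wronskian y g"
proof -
  let ?l = "[:-c, 1:]"
  obtain z where y: "y = ?l ^ r * z" using assms by blast
  have y': "?l ^ (r - 1) dvd pderiv y"
  proof (cases r)
    case (Suc s)
    have "?l ^ s dvd ?l ^ Suc s" by (rule le_imp_power_dvd) simp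
    then show ?thesis unfolding y Suc pderiv_mult pderiv_power_Suc
      by (simp only: diff_Suc_1) (intro dvd_add dvd_mult2 dvd_mult[of _ _ z] dvd_smult dvd_refl)
  qed simp
  have "?l ^ (r - 1) dvd y" using assms by (rule power_le_dvd) simp
  then show "?l ^ (r - 1) dvd wronskian y g"
    unfolding wronskian_def using y' by (intro dvd_diff dvd_mult2) auto
  assume "poly g c = 0"
  then have "?l dvd g" by (simp add: poly_eq_0_iff_dvd)
  show "?l ^ r dvd wronskian y g"
  proof (cases r)
    case (Suc s)
    have "?l ^ s * ?l dvd pderiv y * g" using y' \<open>?l dvd g\<close> Suc by (intro mult_dvd_mono) auto
    then have "?l ^ r dvd pderiv y * g" using Suc by (simp only: power_Suc2)
    moreover have "?l ^ r dvd y * pderiv g" using assms by (rule dvd_mult2)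
    ultimately show ?thesis unfolding wronskian_def by (rule dvd_diff)
  qed simp
qed

text \<open>\<open>y\<close> cuts out the fibre through \<open>c\<close>. Whichever of
  \<open>f\<close>, \<open>g\<close> is nonzero at \<open>c\<close> serves as its partner: their
  Wronskian is a nonzero scalar multiple of that of \<open>f\<close> and \<open>g\<close>.\<close>

lemma wronskian_fibre:
  fixes f g :: "'a :: idom poly" and c :: 'a
  defines "y \<equiv> smult (poly g c) f - smult (poly f c) g"
  assumes "poly f c \<noteq> 0 \<or> poly g c \<noteq> 0" "y \<noteq> 0" "of_nat (order c y) \<noteq> (0 :: 'a)"
  shows "wronskian f g \<noteq> 0 \<and> order c (wronskian f g) = order c y - 1"
proof (cases "poly g c = 0")
  case False
  have W: "wronskian y g = smult (poly g c) (wronskian f g)" by (simp add: y_def wronskian_comb)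
  then show ?thesis using order_wronskian_left[OF assms(3,4) False] False
    by (auto simp: order_smult)
next
  case True
  then have f: "poly f c \<noteq> 0" using assms(2) by auto
  have W: "wronskian y f = smult (poly f c) (wronskian f g)"
    by (subst wronskian_swap) (simp add: y_def wronskian_comb)
  then show ?thesis using order_wronskian_left[OF assms(3,4) f] f
    by (auto simp: order_smult)
qed

text \<open>Linear factors are monic, so a nonzero scalar cancels even when it is not a unit, such
  as \<open>t\<close>.\<close>

lemma power_dvd_smult_iff:
  fixes q :: "'a :: idom poly"
  assumes "c \<noteq> 0"
  shows "[:-a, 1:] ^ n dvd smult c q \<longleftrightarrow> [:-a, 1:] ^ n dvd q"
  using assms by (simp add: order_divides order_smult)

lemma power_dvd_wronskian_of_comb:
  fixes f g :: "'a :: idom poly"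
  assumes "a \<noteq> 0 \<or> b \<noteq> 0" "[:-c, 1:] ^ r dvd smult a f + smult b g"
  shows "[:-c, 1:] ^ (r - 1) dvd wronskian f g"
    and "poly f c = 0 \<Longrightarrow> poly g c = 0 \<Longrightarrow> [:-c, 1:] ^ r dvd wronskian f g"
proof -
  let ?y = "smult a f + smult b g"
  have eq: "wronskian ?y g = smult a (wronskian f g)" "wronskian ?y f = smult (- b) (wronskian f g)"
    by (simp_all add: wronskian_comb wronskian_swap[of _ f])
  from power_dvd_wronskian[OF assms(2), of g] power_dvd_wronskian[OF assms(2), of f]
  show "[:-c, 1:] ^ (r - 1) dvd wronskian f g"
    and "poly f c = 0 \<Longrightarrow> poly g c = 0 \<Longrightarrow> [:-c, 1:] ^ r dvd wronskian f g"
    using assms(1) unfolding eq by (auto simp: power_dvd_smult_iff simp del: smult_minus_left)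
qed

text \<open>Tameness is not assumed: the fibre order exceeds the order of the Wronskian by at most
  one, so the bound on the latter puts it below the characteristic and the tame formula
  applies.\<close>

lemma ram_index_wronskian:
  fixes f g :: "'a :: field poly"
  assumes "poly f c \<noteq> 0 \<or> poly g c \<noteq> 0" "wronskian f g \<noteq> 0"
    and "Suc (order c (wronskian f g)) < CHAR('a)"
  shows "ram_index D f g (Fin c) = Suc (order c (wronskian f g))"
proof -
  define y where "y = smult (poly g c) f - smult (poly f c) g"
  have y: "y = smult (poly g c) f + smult (- poly f c) g" by (simp add: y_def)
  have nz: "poly g c \<noteq> 0 \<or> - poly f c \<noteq> 0" using assms(1) by auto
  have "y \<noteq> 0"
  proof
    assume "y = 0"
    moreover have "wronskian y g = smult (poly g c) (wronskian f g)"
      "wronskian y f = smult (poly f c) (wronskian f g)"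
      by (simp_all add: y_def wronskian_comb wronskian_swap[of _ f])
    ultimately show False using assms(1,2) by auto
  qed
  have "poly y c = 0" by (simp add: y_def)
  then have pos: "order c y > 0" using \<open>y \<noteq> 0\<close> by (simp add: order_root)
  have "[:-c, 1:] ^ (order c y - 1) dvd wronskian f g"
    using power_dvd_wronskian_of_comb(1)[OF nz] order_1[of c y] unfolding y by simp
  then have "order c y - 1 \<le> order c (wronskian f g)" using assms(2) by (simp add: order_divides)
  then have "order c y < CHAR('a)" using assms(3) by linarith
  then have "of_nat (order c y) \<noteq> (0 :: 'a)"
    using pos by (auto simp: of_nat_eq_0_iff_char_dvd dest: dvd_imp_le)
  then show ?thesis
    using wronskian_fibre[of f c g] assms(1) \<open>y \<noteq> 0\<close> pos unfolding y_def by auto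
qed

text \<open>Differences of the points need not be units, so the powers need not be comaximal;
  vanishing orders are compared point by point instead.\<close>

lemma prod_linear_powers_dvd:
  fixes q :: "'a :: idom poly"
  assumes "finite S" "inj_on P S" "\<And>i. i \<in> S \<Longrightarrow> [:- P i, 1:] ^ r i dvd q"
  shows "(\<Prod>i\<in>S. [:- P i, 1:] ^ r i) dvd q"
proof (cases "q = 0")
  case False
  show ?thesis using assms
  proof (induction S)
    case (insert j S)
    let ?\<Pi> = "\<Prod>i\<in>S. [:- P i, 1:] ^ r i"
    from insert obtain z where z: "q = ?\<Pi> * z" by (auto simp: inj_on_insert)
    have "poly ?\<Pi> (P j) \<noteq> 0" using insert by (auto simp: poly_prod inj_on_def)
    moreover have "r j \<le> order (P j) q" using insert.prems(2)[of j] False by (simp add: order_divides)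
    ultimately have "r j \<le> order (P j) z" using False unfolding z
      by (auto simp: order_mult order_0I)
    then have "[:- P j, 1:] ^ r j dvd z" by (simp add: order_divides)
    then show ?case using insert(1,2) z by (simp add: mult_dvd_mono mult.commute)
  qed simp
qed simp

lemma degree_prod_linear_powers:
  "degree (\<Prod>i\<in>S. [:- P i, 1 :: 'a :: idom:] ^ r i) = (\<Sum>i\<in>S. r i)"
  by (induction S rule: infinite_finite_induct)
    (auto simp: degree_mult_eq degree_power_eq)

lemma order_prod_linear_powers:
  fixes P :: "'i \<Rightarrow> 'a :: idom"
  assumes "finite S"
  shows "order c (\<Prod>i\<in>S. [:- P i, 1:] ^ r i) = (\<Sum>i\<in>{i\<in>S. P i = c}. r i)"
  using assms
proof (induction S)
  case (insert j S)
  have *: "order c ([:- P j, 1:] ^ r j) = (if P j = c then r j else 0)"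
    by (auto simp: order_power_n_n intro!: order_0I)
  have "{i \<in> insert j S. P i = c} = (if P j = c then insert j {i\<in>S. P i = c} else {i\<in>S. P i = c})"
    by auto
  then show ?case using insert * by (simp add: order_mult)
qed simp

section \<open>Separability\<close>

text \<open>Gaussian elimination: a polynomial with nonzero top coefficient is the pivot and clears
  that coefficient from the others.\<close>

lemma poly_linear_relation:
  fixes v :: "'i \<Rightarrow> 'a :: field poly"
  assumes "finite I" "\<forall>i\<in>I. \<forall>n\<ge>M. coeff (v i) n = 0" "M < card I"
  shows "\<exists>c. (\<exists>i\<in>I. c i \<noteq> 0) \<and> (\<Sum>i\<in>I. smult (c i) (v i)) = 0"
  using assms
proof (induction M arbitrary: I v)
  case 0
  then have "v i = 0" if "i \<in> I" for i using that by (intro poly_eqI) auto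
  moreover have "I \<noteq> {}" using 0 by auto
  ultimately show ?case by (intro exI[of _ "\<lambda>_. 1"]) auto
next
  case (Suc M)
  show ?case
  proof (cases "\<forall>i\<in>I. coeff (v i) M = 0")
    case True
    then have "\<forall>i\<in>I. \<forall>n\<ge>M. coeff (v i) n = 0"
      using Suc.prems(2) by (metis not_less_eq_eq le_antisym)
    then show ?thesis using Suc.IH[of I v] Suc.prems by auto
  next
    case False
    then obtain i0 where i0: "i0 \<in> I" "coeff (v i0) M \<noteq> 0" by auto
    define r where "r i = coeff (v i) M / coeff (v i0) M" for i
    define w where "w i = v i - smult (r i) (v i0)" for i
    have "\<forall>i\<in>I - {i0}. \<forall>n\<ge>M. coeff (w i) n = 0"
    proof (intro ballI allI impI)
      fix i n assume "i \<in> I - {i0}" "M \<le> n"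
      then show "coeff (w i) n = 0"
        using Suc.prems(2) i0 by (cases "n = M") (auto simp: w_def r_def)
    qed
    moreover have "M < card (I - {i0})" using Suc.prems i0 by simp
    ultimately obtain c i where c: "i \<in> I - {i0}" "c i \<noteq> 0" "(\<Sum>i\<in>I - {i0}. smult (c i) (w i)) = 0"
      using Suc.IH[of "I - {i0}" w] Suc.prems by auto
    \<comment> \<open>The pivot receives the coefficient that undoes the eliminations.\<close>
    define c' where "c' = c(i0 := - (\<Sum>i\<in>I - {i0}. c i * r i))"
    have "(\<Sum>i\<in>I. smult (c' i) (v i)) = smult (c' i0) (v i0) + (\<Sum>i\<in>I - {i0}. smult (c i) (v i))"
      using i0 Suc.prems by (subst sum.remove[of _ i0]) (auto simp: c'_def intro!: sum.cong)
    also have "\<dots> = (\<Sum>i\<in>I - {i0}. smult (c i) (w i))"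
      by (simp add: c'_def w_def smult_diff_right sum_subtractf smult_sum)
    finally show ?thesis using c by (intro exI[of _ c']) (auto simp: c'_def)
  qed
qed

text \<open>Only exponents divisible by p survive, and Frobenius is additive, so roots of the
  coefficients assemble to a root of \<open>q\<close>. Asking for roots coefficientwise lets the
  lemma be iterated to two variables.\<close>

lemma poly_power_CHAR:
  fixes q :: "'a :: idom poly"
  assumes "prime CHAR('a)" "pderiv q = 0" "\<And>i. \<exists>c. coeff q i = c ^ CHAR('a)"
  shows "\<exists>r. q = r ^ CHAR('a)"
proof -
  let ?p = "CHAR('a)"
  have p: "?p > 0" using assms(1) by (rule prime_gt_0_nat)
  obtain c where c: "\<And>i. coeff q i = c i ^ ?p" using assms(3) by metis
  define r where "r = (\<Sum>j\<le>degree q. monom (c (?p * j)) j)"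
  have zero: "coeff q i = 0" if "\<not> ?p dvd i" for i
  proof (cases i)
    case (Suc k)
    have "of_nat (Suc k) * coeff q (Suc k) = 0"
      using assms(2) by (metis coeff_pderiv coeff_0)
    then show ?thesis using that Suc by (simp add: of_nat_eq_0_iff_char_dvd del: of_nat_Suc)
  qed (use that in simp)
  have "r ^ ?p = (\<Sum>j\<le>degree q. monom (c (?p * j)) j ^ ?p)"
    unfolding r_def by (rule freshmans_dream_sum) (use assms in simp_all)
  also have "\<dots> = (\<Sum>j\<le>degree q. monom (coeff q (?p * j)) (?p * j))"
    by (simp add: monom_power c mult.commute)
  also have "\<dots> = q"
  proof (rule poly_eqI)
    fix i
    show "coeff (\<Sum>j\<le>degree q. monom (coeff q (?p * j)) (?p * j)) i = coeff q i"
    proof (cases "?p dvd i")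
      case False
      then show ?thesis using zero[of i] by (auto simp: coeff_sum intro!: sum.neutral)
    next
      case True
      then obtain j where j: "i = ?p * j" by auto
      have "coeff q i = 0" if "degree q < j"
      proof (rule coeff_eq_0)
        have "j \<le> i" using p by (simp add: j)
        then show "degree q < i" using that by simp
      qed
      then show ?thesis using p by (auto simp: coeff_sum j sum.delta)
    qed
  qed
  finally show ?thesis by auto
qed

section \<open>The derivation \<open>d/dx\<close> on the function field\<close>

definition fract_deriv :: "'a :: idom poly fract \<Rightarrow> 'a poly fract" where
  "fract_deriv x = (SOME z. \<exists>a b. b \<noteq> 0 \<and> x = Fract a b \<and> z = Fract (wronskian a b) (b ^ 2))"

text \<open>The quotient rule is independent of the representation, which justifies the choice
  operator: extending a fraction by \<open>h\<close> multiplies Wronskian and squared denominator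
  alike by \<open>h^2\<close>.\<close>

lemma fract_deriv_Fract:
  assumes "b \<noteq> 0"
  shows "fract_deriv (Fract a b) = Fract (wronskian a b) (b ^ 2)"
  unfolding fract_deriv_def
proof (rule some_equality)
  fix z
  assume "\<exists>c d. d \<noteq> 0 \<and> Fract a b = Fract c d \<and> z = Fract (wronskian c d) (d ^ 2)"
  then obtain c d where d: "d \<noteq> 0" "Fract a b = Fract c d" "z = Fract (wronskian c d) (d ^ 2)"
    by blast
  have "d ^ 2 * wronskian a b = wronskian (d * a) (d * b)"
    "b ^ 2 * wronskian c d = wronskian (b * c) (b * d)" by (simp_all add: wronskian_mult)
  moreover have "d * a = b * c" using d assms by (simp add: eq_fract mult.commute)
  ultimately show "z = Fract (wronskian a b) (b ^ 2)"
    using d assms by (simp add: eq_fract mult.commute)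
qed (use assms in blast)

lemma fract_deriv_add: "fract_deriv (x + y) = fract_deriv x + fract_deriv y"
proof (cases x, cases y)
  fix a b c d :: "'a poly"
  assume *: "x = Fract a b" "b \<noteq> 0" "y = Fract c d" "d \<noteq> 0"
  have "wronskian (a * d + c * b) (b * d) = d ^ 2 * wronskian a b + b ^ 2 * wronskian c d"
    by (simp add: wronskian_def pderiv_add pderiv_mult algebra_simps power2_eq_square)
  then show ?thesis using * by (simp add: fract_deriv_Fract power_mult_distrib mult.commute)
qed

lemma fract_deriv_mult: "fract_deriv (x * y) = fract_deriv x * y + x * fract_deriv y"
proof (cases x, cases y)
  fix a b c d :: "'a poly"
  assume *: "x = Fract a b" "b \<noteq> 0" "y = Fract c d" "d \<noteq> 0"
  have "wronskian (a * c) (b * d) = wronskian a b * (c * d) + a * b * wronskian c d"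
    by (simp add: wronskian_def pderiv_mult algebra_simps)
  then show ?thesis using *
    by (simp add: fract_deriv_Fract eq_fract) (simp add: algebra_simps power2_eq_square)
qed

lemma fract_deriv_const [simp]: "fract_deriv (const_fract c) = 0"
  by (simp add: const_fract_def to_fract_def fract_deriv_Fract wronskian_def Zero_fract_def pderiv_pCons)

lemma unital_ring_hom_const_fract: "unital_ring_hom const_fract"
proof -
  have "to_fract [:1 :: 'a:] = 1" by (simp flip: one_pCons)
  then show ?thesis
    by (simp add: unital_ring_hom_def const_fract_def flip: to_fract_add to_fract_mult)
qed

lemma fract_deriv_0 [simp]: "fract_deriv (0 :: 'a :: field poly fract) = 0"
  using fract_deriv_const[of "0 :: 'a"]
  by (simp only: unital_ring_hom_simps[OF unital_ring_hom_const_fract])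

lemma unital_ring_hom_poly_map_poly:
  assumes "unital_ring_hom h"
  shows "unital_ring_hom (\<lambda>s. poly (map_poly h s) x)"
  using unital_ring_hom_simps[OF unital_ring_hom_map_poly[OF assms]]
  by (simp add: unital_ring_hom_def)

section \<open>Algebraic relations between two elements of the function field\<close>

definition eval_fract :: "'a :: field poly fract \<Rightarrow> 'a poly \<Rightarrow> 'a poly fract" where
  "eval_fract \<phi> s = poly (map_poly const_fract s) \<phi>"

definition eval_fract2 :: "'a :: field poly fract \<Rightarrow> 'a poly fract \<Rightarrow> 'a poly poly \<Rightarrow> 'a poly fract" where
  "eval_fract2 \<phi> y R = poly (map_poly (eval_fract \<phi>) R) y"

lemma unital_ring_hom_eval_fract: "unital_ring_hom (eval_fract \<phi>)"
  unfolding eval_fract_def[abs_def]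
  by (rule unital_ring_hom_poly_map_poly[OF unital_ring_hom_const_fract])

lemma unital_ring_hom_eval_fract2: "unital_ring_hom (eval_fract2 \<phi> y)"
  unfolding eval_fract2_def[abs_def]
  by (rule unital_ring_hom_poly_map_poly[OF unital_ring_hom_eval_fract])

lemma eval_fract_pCons: "eval_fract \<phi> (pCons c s) = const_fract c + \<phi> * eval_fract \<phi> s"
  by (simp add: eval_fract_def map_poly_hom_simps[OF unital_ring_hom_const_fract])

lemma eval_fract2_pCons: "eval_fract2 \<phi> y (pCons s R) = eval_fract \<phi> s + y * eval_fract2 \<phi> y R"
  by (simp add: eval_fract2_def map_poly_hom_simps[OF unital_ring_hom_eval_fract])

lemma fract_deriv_eval_fract:
  "fract_deriv (eval_fract \<phi> s) = eval_fract \<phi> (pderiv s) * fract_deriv \<phi>"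
proof (induction s)
  case (pCons c s)
  then show ?case
    by (simp add: eval_fract_pCons pderiv_pCons fract_deriv_add fract_deriv_mult
        unital_ring_hom_simps[OF unital_ring_hom_eval_fract])
      (simp add: const_fract_def algebra_simps)
qed (simp add: unital_ring_hom_simps[OF unital_ring_hom_eval_fract])

text \<open>The chain rule: \<open>pderiv R\<close> is the partial derivative in the outer variable
  \<open>y\<close>, \<open>map_poly pderiv R\<close> the one in the inner variable
  \<open>\<phi>\<close>.\<close>

lemma fract_deriv_eval_fract2:
  "fract_deriv (eval_fract2 \<phi> y R) =
     eval_fract2 \<phi> y (pderiv R) * fract_deriv y + eval_fract2 \<phi> y (map_poly pderiv R) * fract_deriv \<phi>"
proof (induction R)
  case (pCons s R)
  then show ?case
    by (simp add: eval_fract2_pCons pderiv_pCons map_poly_pCons fract_deriv_add fract_deriv_mult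
        fract_deriv_eval_fract unital_ring_hom_simps[OF unital_ring_hom_eval_fract2]
        unital_ring_hom_simps[OF unital_ring_hom_eval_fract])
      (simp add: algebra_simps)
qed (simp add: unital_ring_hom_simps[OF unital_ring_hom_eval_fract2])

text \<open>\<open>\<phi>\<close> is transcendental: over an algebraically closed field a vanishing
  polynomial in it would have a vanishing linear factor, making \<open>\<phi>\<close> a constant
  with zero derivative.\<close>

lemma eval_fract_neq_0:
  fixes \<phi> :: "'a :: alg_closed_field poly fract"
  assumes "fract_deriv \<phi> \<noteq> 0" "s \<noteq> 0"
  shows "eval_fract \<phi> s \<noteq> 0"
  using assms(2)
proof (induction "degree s" arbitrary: s rule: less_induct)
  case less
  note hom = unital_ring_hom_simps[OF unital_ring_hom_eval_fract]
  show ?case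
  proof (cases "degree s = 0")
    case True
    then obtain c where "s = [:c:]" using degree_0_id by metis
    then show ?thesis using less.prems by (simp add: eval_fract_pCons hom const_fract_def)
  next
    case False
    then obtain c where "poly s c = 0" using alg_closed_imp_poly_has_root by blast
    then obtain r where r: "s = [:-c, 1:] * r" by (auto simp: poly_eq_0_iff_dvd)
    then have "r \<noteq> 0" using less.prems by auto
    then have "degree r < degree s" using r by (simp add: degree_mult_eq del: mult_pCons_left)
    then have "eval_fract \<phi> r \<noteq> 0" using less.hyps \<open>r \<noteq> 0\<close> by blast
    moreover have "eval_fract \<phi> [:-c, 1:] \<noteq> 0"
    proof
      assume "eval_fract \<phi> [:-c, 1:] = 0"
      then have "\<phi> = const_fract c"
        by (simp add: eval_fract_pCons hom unital_ring_hom_simps[OF unital_ring_hom_const_fract])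
      then show False using assms(1) by simp
    qed
    ultimately show ?thesis by (simp add: r hom del: mult_pCons_left)
  qed
qed

text \<open>Dimension count: the products \<open>y^i \<phi>^j\<close> with
  \<open>i, j \<le> N\<close>, cleared of denominators, are too many polynomials of bounded degree
  to be independent.\<close>

lemma algebraic_relation:
  fixes \<phi> y :: "'a :: field poly fract"
  shows "\<exists>R. R \<noteq> 0 \<and> eval_fract2 \<phi> y R = 0"
proof -
  obtain f g where \<phi>: "\<phi> = Fract f g" "g \<noteq> 0" by (cases \<phi>)
  obtain a b where y: "y = Fract a b" "b \<noteq> 0" by (cases y)
  define \<delta> where "\<delta> = Max {degree f, degree g, degree a, degree b}"
  have \<delta>: "degree f \<le> \<delta>" "degree g \<le> \<delta>" "degree a \<le> \<delta>" "degree b \<le> \<delta>"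
    unfolding \<delta>_def by (auto intro: Max_ge)
  \<comment> \<open>There are \<open>(N + 1)^2\<close> products of degree at most
    \<open>2 N \<delta>\<close>; this choice of \<open>N\<close> makes their number exceed the
    dimension \<open>2 N \<delta> + 1\<close>.\<close>
  define N where "N = 2 * \<delta> + 1"
  define I where "I = {..N} \<times> {..N}"
  define v where "v = (\<lambda>(i, j). a ^ i * b ^ (N - i) * (f ^ j * g ^ (N - j)))"
  have deg: "degree (r ^ i * s ^ (N - i)) \<le> N * \<delta>" if "degree r \<le> \<delta>" "degree s \<le> \<delta>" "i \<le> N"
    for r s :: "'a poly" and i
  proof -
    have "degree (r ^ i * s ^ (N - i)) \<le> degree r * i + degree s * (N - i)"
      by (intro order_trans[OF degree_mult_le] add_mono degree_power_le)
    also have "\<dots> \<le> \<delta> * i + \<delta> * (N - i)" using that by (intro add_mono mult_le_mono1)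
    also have "\<dots> = N * \<delta>" using that(3) by (simp add: add_mult_distrib2[symmetric] mult.commute)
    finally show ?thesis .
  qed
  have "\<forall>i\<in>I. \<forall>n\<ge>2 * N * \<delta> + 1. coeff (v i) n = 0"
  proof (clarsimp simp: I_def v_def)
    fix i j n assume "i \<le> N" "j \<le> N" "Suc (2 * N * \<delta>) \<le> n"
    then have "degree (a ^ i * b ^ (N - i) * (f ^ j * g ^ (N - j))) < n"
      using deg[OF \<delta>(3,4), of i] deg[OF \<delta>(1,2), of j]
        degree_mult_le[of "a ^ i * b ^ (N - i)" "f ^ j * g ^ (N - j)"] by linarith
    then show "coeff (a ^ i * b ^ (N - i) * (f ^ j * g ^ (N - j))) n = 0" by (rule coeff_eq_0)
  qed
  moreover have "2 * N * \<delta> + 1 < card I"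
    by (simp add: I_def card_cartesian_product N_def algebra_simps)
  ultimately obtain c i0 j0 where c: "(i0, j0) \<in> I" "c (i0, j0) \<noteq> 0" "(\<Sum>i\<in>I. smult (c i) (v i)) = 0"
    using poly_linear_relation[of I "2 * N * \<delta> + 1" v] by (force simp: I_def)
  define R where "R = (\<Sum>i\<in>I. monom (monom (c i) (snd i)) (fst i))"
  note hom2 = unital_ring_hom_simps[OF unital_ring_hom_eval_fract2]
  have sum: "eval_fract2 \<phi> y (sum u I) = (\<Sum>i\<in>I. eval_fract2 \<phi> y (u i))" for u
    by (induction I rule: infinite_finite_induct) (simp_all add: hom2)
  have ev: "eval_fract2 \<phi> y R = (\<Sum>i\<in>I. const_fract (c i) * \<phi> ^ snd i * y ^ fst i)"
    by (simp add: R_def sum)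
      (simp add: eval_fract2_def map_poly_hom_simps[OF unital_ring_hom_eval_fract] poly_monom
        eval_fract_def map_poly_hom_simps[OF unital_ring_hom_const_fract])
  have "to_fract (b ^ N * g ^ N) * (const_fract (c i) * \<phi> ^ snd i * y ^ fst i) = to_fract (smult (c i) (v i))"
    if "i \<in> I" for i
  proof -
    have pow: "to_fract (s ^ N) * (to_fract r / to_fract s) ^ k = to_fract (r ^ k * s ^ (N - k))"
      if "s \<noteq> 0" "k \<le> N" for r s :: "'a poly" and k
    proof -
      have "s ^ N = s ^ k * s ^ (N - k)" using that by (simp flip: power_add)
      then show ?thesis
        using that by (simp add: unital_ring_hom_simps[OF unital_ring_hom_to_fract] power_divide)
    qed
    have "to_fract (smult (c i) (v i)) = const_fract (c i) * to_fract (v i)"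
      by (simp add: const_fract_def flip: to_fract_mult)
    moreover have "to_fract (v i) = (to_fract (b ^ N) * y ^ fst i) * (to_fract (g ^ N) * \<phi> ^ snd i)"
      using that pow[OF \<open>b \<noteq> 0\<close>, of "fst i" a] pow[OF \<open>g \<noteq> 0\<close>, of "snd i" f]
      by (auto simp only: I_def v_def \<phi> y Fract_conv_to_fract to_fract_mult mem_Times_iff atMost_iff case_prod_unfold)
    ultimately show ?thesis by (simp only: to_fract_mult mult_ac)
  qed
  then have "to_fract (b ^ N * g ^ N) * eval_fract2 \<phi> y R = to_fract (\<Sum>i\<in>I. smult (c i) (v i))"
    by (simp add: ev sum_distrib_left del: to_fract_mult)
  then have "eval_fract2 \<phi> y R = 0" using c(3) y \<phi> by simp
  moreover have "coeff (coeff R i0) j0 = (\<Sum>i\<in>I. if i = (i0, j0) then c i else 0)"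
    unfolding R_def coeff_sum by (intro sum.cong) (auto simp: prod_eq_iff)
  then have "R \<noteq> 0" using c(1,2) by (auto simp: I_def)
  ultimately show ?thesis by blast
qed

text \<open>
  Take a polynomial relation \<open>R(\<phi>, y) = 0\<close> of least degree in \<open>y\<close>, and then of least size. If \<open>R\<close>
  had zero derivative in \<open>y\<close>, differentiating the relation would give the smaller relation
  \<open>R\<^sub>S(\<phi>, y) \<phi>' = 0\<close>; so both partial derivatives would vanish and \<open>R\<close> would be a \<open>p\<close>-th power.
\<close>
theorem separable_map_if_wronskian:
  fixes f g :: "'a :: alg_closed_field poly"
  assumes "CHAR('a) > 0" "wronskian f g \<noteq> 0"
  shows "separable_map f g"
  unfolding separable_map_def
proof
  fix y
  let ?p = "CHAR('a)"
  have prime: "prime ?p" using assms(1) by (rule prime_CHAR_semidom)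
  have "g \<noteq> 0" using assms(2) by auto
  define \<phi> where "\<phi> = to_fract f / to_fract g"
  have "fract_deriv \<phi> = Fract (wronskian f g) (g ^ 2)"
    using \<open>g \<noteq> 0\<close> by (simp add: \<phi>_def flip: Fract_conv_to_fract) (simp add: fract_deriv_Fract)
  then have \<phi>: "fract_deriv \<phi> \<noteq> 0" using assms(2) \<open>g \<noteq> 0\<close> by (simp add: Fract_conv_to_fract)
  note hom1 = unital_ring_hom_simps[OF unital_ring_hom_eval_fract]
  note hom2 = unital_ring_hom_simps[OF unital_ring_hom_eval_fract2]
  let ?ev = "eval_fract2 \<phi> y"
  let ?van = "\<lambda>R. R \<noteq> 0 \<and> ?ev R = 0"
  let ?size = "\<lambda>R :: 'a poly poly. \<Sum>i\<le>degree R. degree (coeff R i)"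
  obtain R0 where R0: "?van R0" and min0: "\<And>R. ?van R \<Longrightarrow> degree R0 \<le> degree R"
    using ex_has_least_nat[of ?van _ degree] algebraic_relation by metis
  obtain R where R: "?van R" "degree R = degree R0"
    and min_size: "\<And>R'. ?van R' \<Longrightarrow> degree R' = degree R0 \<Longrightarrow> ?size R \<le> ?size R'"
    using ex_has_least_nat[of "\<lambda>R. ?van R \<and> degree R = degree R0" R0 ?size] R0 by metis
  have min: "degree R \<le> degree R'" if "?van R'" for R' using min0[OF that] R by simp
  have pos: "degree R > 0"
  proof (rule ccontr)
    assume "\<not> degree R > 0"
    then obtain s where "R = [:s:]" using degree_0_id by (metis gr0I)
    then show False using R(1) eval_fract_neq_0[OF \<phi>, of s] by (simp add: eval_fract2_pCons hom2)
  qed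
  have R': "pderiv R \<noteq> 0"
  proof
    assume *: "pderiv R = 0"
    have "fract_deriv (?ev R) = 0" using R(1) by simp
    then have ev: "?ev (map_poly pderiv R) = 0"
      using * \<phi> by (simp add: fract_deriv_eval_fract2 hom2)
    have "map_poly pderiv R = 0"
    proof (rule ccontr)
      assume nz: "map_poly pderiv R \<noteq> 0"
      have deg: "degree (map_poly pderiv R) = degree R"
        using min[of "map_poly pderiv R"] nz ev
        by (intro antisym degree_le) (auto simp: coeff_map_poly coeff_eq_0)
      obtain i where i: "pderiv (coeff R i) \<noteq> 0"
        using nz by (metis coeff_0 coeff_map_poly pderiv_0 poly_eqI)
      note le = degree_pderiv_le
      have "?size (map_poly pderiv R) < ?size R"
        unfolding deg
      proof (rule sum_strict_mono_ex1)
        show "\<forall>i\<in>{..degree R}. degree (coeff (map_poly pderiv R) i) \<le> degree (coeff R i)"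
          using le order_trans[OF le diff_le_self] by (auto simp: coeff_map_poly)
        have "degree (coeff R i) > 0" using i by (metis degree_0_id gr0I pderiv_singleton)
        moreover have "i \<le> degree R" using i by (metis coeff_eq_0 not_le pderiv_0)
        ultimately show "\<exists>i\<in>{..degree R}. degree (coeff (map_poly pderiv R) i) < degree (coeff R i)"
          using le[of "coeff R i"] by (intro bexI[of _ i]) (auto simp: coeff_map_poly)
      qed simp
      then show False using min_size[of "map_poly pderiv R"] nz ev deg R(2) by simp
    qed
    then have "pderiv (coeff R i) = 0" for i by (metis coeff_0 coeff_map_poly pderiv_0)
    \<comment> \<open>Two passes of the root lemma: each coefficient of \<open>R\<close> is a p-th
      power because the ground field has p-th roots, and then so is \<open>R\<close>. The root is a
      relation of smaller degree.\<close>
    then have "\<exists>c. coeff R i = c ^ CHAR('a poly)" for i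
      using poly_power_CHAR[OF prime, of "coeff R i"] nth_root_exists[OF assms(1)]
      by (metis semiring_char_poly)
    then obtain R1 where R1: "R = R1 ^ ?p"
      using poly_power_CHAR[of R] prime * by (metis semiring_char_poly)
    have "R1 \<noteq> 0" using R1 R(1) assms(1) by auto
    moreover have "?ev R1 = 0" using R(1) by (simp add: R1 hom2)
    ultimately have "degree R \<le> degree R1" using min by blast
    moreover have "degree R = ?p * degree R1" using R1 \<open>R1 \<noteq> 0\<close> by (simp add: degree_power_eq)
    ultimately show False using pos prime_gt_1_nat[OF prime] by simp
  qed
  have degR': "degree (pderiv R) < degree R"
    using degree_pderiv_le[of R] pos by linarith
  \<comment> \<open>A nonzero element \<open>r\<close> of least degree in the ideal of
    \<open>R\<close> and its derivative divides a scalar multiple of \<open>R\<close>. If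
    \<open>r\<close> were not constant, the cofactor would be a relation of smaller degree, because
    \<open>r\<close> itself does not vanish at \<open>(\<phi>, y)\<close>.\<close>
  let ?I = "\<lambda>r. r \<noteq> 0 \<and> (\<exists>A B. r = A * R + B * pderiv R)"
  have I': "?I (pderiv R)" using R' by (metis add_0 mult_1 mult_zero_left)
  then obtain r where r: "?I r" and rmin: "\<And>r'. ?I r' \<Longrightarrow> degree r \<le> degree r'"
    using ex_has_least_nat[of ?I _ degree] by metis
  obtain A B where AB: "r = A * R + B * pderiv R" using r by auto
  obtain a q where a: "a \<noteq> 0" and q: "smult a R = r * q + pseudo_mod R r"
    using pseudo_mod(1)[of r R] r by blast
  have "pseudo_mod R r = 0"
  proof (rule ccontr)
    assume nz: "pseudo_mod R r \<noteq> 0"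
    have "pseudo_mod R r = smult a R - r * q" using q by simp
    also have "\<dots> = ([:a:] - A * q) * R + (- B * q) * pderiv R" by (simp add: AB algebra_simps)
    finally have "degree r \<le> degree (pseudo_mod R r)" using rmin nz by blast
    then show False using pseudo_mod(2)[of r R] r nz by auto
  qed
  then have q: "smult a R = r * q" using q by simp
  then have "r * q \<noteq> 0" using a R(1) by (metis smult_eq_0_iff)
  then have "degree R = degree r + degree q"
    using q a by (metis degree_mult_eq degree_smult_eq mult_eq_0_iff)
  moreover have "?ev r \<noteq> 0" using min[of r] r rmin[OF I'] degR' by auto
  moreover have "?ev r * ?ev q = ?ev ([:a:] * R)" using q by (simp add: flip: hom2(3))
  then have "?ev r * ?ev q = 0" using R(1) by (simp only: hom2(3)) simp
  ultimately have "degree r = 0" using min[of q] \<open>r * q \<noteq> 0\<close> by auto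
  then obtain s where s: "r = [:s:]" using degree_0_id by metis
  \<comment> \<open>Substituting \<open>\<phi>\<close> for the inner variable gives a polynomial
    over \<open>K(\<phi>)\<close> with root \<open>y\<close>; the identity for the constant
    \<open>r\<close> becomes a Bezout identity.\<close>
  define P where "P = map_poly (eval_fract \<phi>) R"
  note homP = unital_ring_hom_simps[OF unital_ring_hom_map_poly[OF unital_ring_hom_eval_fract]]
  have P': "pderiv P = map_poly (eval_fract \<phi>) (pderiv R)"
    unfolding P_def by (rule pderiv_map_poly[OF unital_ring_hom_eval_fract])
  have "map_poly (eval_fract \<phi>) r = map_poly (eval_fract \<phi>) A * P + map_poly (eval_fract \<phi>) B * pderiv P"
    by (simp only: AB P' homP) (simp only: P_def)
  then have bezout: "[:eval_fract \<phi> s:] = map_poly (eval_fract \<phi>) A * P + map_poly (eval_fract \<phi>) B * pderiv P"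
    by (simp add: s map_poly_hom_simps[OF unital_ring_hom_eval_fract])
  have unit: "eval_fract \<phi> s \<noteq> 0" using eval_fract_neq_0[OF \<phi>] r s by auto
  have "coprime P (pderiv P)"
  proof (rule coprimeI)
    fix u assume "u dvd P" "u dvd pderiv P"
    then have "u dvd [:eval_fract \<phi> s:]" unfolding bezout by (intro dvd_add dvd_mult)
    moreover have "[:eval_fract \<phi> s:] dvd 1"
      using unit by (simp add: is_unit_const_poly_iff dvd_field_iff)
    ultimately show "u dvd 1" by (rule dvd_trans)
  qed
  moreover have "coeff P i \<in> subfield_gen \<phi>" for i
    unfolding subfield_gen_def P_def
    by (simp add: coeff_map_poly hom1 eval_fract_def, intro exI[of _ "coeff R i"] exI[of _ 1])
      (simp add: unital_ring_hom_simps[OF unital_ring_hom_map_poly[OF unital_ring_hom_const_fract]])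
  moreover have "poly P y = 0" using R(1) by (simp add: P_def eval_fract2_def)
  ultimately show "separable_over (subfield_gen (to_fract f / to_fract g)) y"
    unfolding separable_over_def \<phi>_def by blast
qed

section \<open>Degrees and constants of the derivation\<close>

lemma wronskian_degree:
  fixes f g :: "'a :: idom poly"
  assumes "f \<noteq> 0" "g \<noteq> 0" "of_nat (degree f) \<noteq> (of_nat (degree g) :: 'a)"
  shows "wronskian f g \<noteq> 0" "degree (wronskian f g) = degree f + degree g - 1"
proof -
  have pos: "0 < degree f + degree g" using assms(3) by (auto intro!: gr0I)
  then have "coeff (wronskian f g) (degree f + degree g - 1) \<noteq> 0"
    using assms by (simp only: wronskian_top(1)[OF order_refl order_refl]) simp
  then show "wronskian f g \<noteq> 0" "degree (wronskian f g) = degree f + degree g - 1"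
    using wronskian_top(2)[OF order_refl order_refl pos] le_degree by (auto intro: antisym)
qed

lemma degree_mod_CHAR:
  fixes q :: "'a :: idom poly"
  assumes "pderiv q = 0"
  shows "of_nat (degree q) = (0 :: 'a)"
proof (cases "degree q")
  case (Suc k)
  then have "coeff q (Suc k) \<noteq> 0" by (metis degree_0 leading_coeff_0_iff nat.distinct(1))
  moreover have "of_nat (Suc k) * coeff q (Suc k) = 0" using assms by (metis coeff_pderiv coeff_0)
  ultimately show ?thesis using Suc by simp
qed simp

text \<open>Multiplication by a constant of the derivation preserves degrees modulo the characteristic,
  so no cancellation of leading terms can occur.\<close>
lemma degree_le_of_comb:
  fixes f g :: "'a :: idom poly"
  assumes "of_nat (degree f) \<noteq> (of_nat (degree g) :: 'a)" "degree g < degree f"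
    and "pderiv a = 0" "pderiv b = 0" "a * f + b * g \<noteq> 0"
  shows "degree g \<le> degree (a * f + b * g)"
proof -
  have g: "degree g \<le> degree (b * g)" if "b * g \<noteq> 0"
    using that degree_mult_eq[of b g] by auto
  have f: "degree f \<le> degree (a * f)" if "a * f \<noteq> 0"
    using that degree_mult_eq[of a f] by auto
  show ?thesis
  proof (cases "a * f = 0 \<or> b * g = 0")
    case True
    then show ?thesis using f g assms(2,5) by (cases "a * f = 0") auto
  next
    case False
    then have "of_nat (degree (a * f)) = (of_nat (degree f) :: 'a)"
      "of_nat (degree (b * g)) = (of_nat (degree g) :: 'a)"
      using degree_mult_eq[of a f] degree_mult_eq[of b g] degree_mod_CHAR[OF assms(3)]
        degree_mod_CHAR[OF assms(4)] by auto
    then have "degree (a * f) \<noteq> degree (b * g)" using assms(1) by metis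
    then have "degree (b * g) \<le> degree (a * f + b * g)"
      using degree_add_eq_left[of "b * g" "a * f"] degree_add_eq_right[of "a * f" "b * g"]
      by (cases "degree (a * f) < degree (b * g)") auto
    then show ?thesis using g False by auto
  qed
qed

lemma CHAR_dvd_degree_diff:
  fixes f g :: "'a :: idom poly"
  assumes "f \<noteq> 0" "g \<noteq> 0" "wronskian f g = 0" "degree g \<le> degree f"
  shows "CHAR('a) dvd degree f - degree g"
proof -
  have "of_nat (degree f) = (of_nat (degree g) :: 'a)" using wronskian_degree[of f g] assms by auto
  then show ?thesis using assms(4) by (simp add: of_nat_diff flip: of_nat_eq_0_iff_char_dvd)
qed

text \<open>A zero Wronskian forces the degrees to agree modulo p, so unequal degrees differ by at
  least p. This is the source of the bound \<open>m \<ge> p\<close>.\<close>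

lemma small_degree_comb:
  fixes f g :: "'a :: field poly"
  assumes indep: "\<forall>a b. smult a f + smult b g = 0 \<longrightarrow> a = 0 \<and> b = 0"
    and "wronskian f g = 0" "degree f \<le> d" "degree g \<le> d"
  shows "\<exists>a b. smult a f + smult b g \<noteq> 0 \<and> degree (smult a f + smult b g) + CHAR('a) \<le> d"
proof -
  have dvd_imp: "degree g' + CHAR('a) \<le> d"
    if "f' \<noteq> 0" "g' \<noteq> 0" "wronskian f' g' = 0" "degree g' < degree f'" "degree f' \<le> d"
    for f' g' :: "'a poly"
    using CHAR_dvd_degree_diff[of f' g'] dvd_imp_le[of "CHAR('a)" "degree f' - degree g'"] that by auto
  have f: "f \<noteq> 0" using indep[rule_format, of 1 0] by auto
  have g: "g \<noteq> 0" using indep[rule_format, of 0 1] by auto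
  consider "degree f < degree g" | "degree g < degree f" | "degree f = degree g" by linarith
  then show ?thesis
  proof cases
    case 1
    then show ?thesis using dvd_imp[of g f] f g assms by (intro exI[of _ 1] exI[of _ 0]) (auto simp: wronskian_swap[of g])
  next
    case 2
    then show ?thesis using dvd_imp[of f g] f g assms by (intro exI[of _ 0] exI[of _ 1]) auto
  next
    case 3
    \<comment> \<open>For equal degrees the leading terms are cancelled first; independence keeps
      the result nonzero, and its Wronskian with \<open>g\<close> is still zero.\<close>
    define h where "h = smult (lead_coeff g) f + smult (- lead_coeff f) g"
    have h: "h \<noteq> 0" using indep[rule_format, of "lead_coeff g" "- lead_coeff f"] g unfolding h_def by auto
    have W: "wronskian g h = 0"
      unfolding h_def using assms(2) wronskian_comb(1)[of "- lead_coeff f" g "lead_coeff g" f]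
      by (simp add: add.commute wronskian_def pderiv_add pderiv_diff pderiv_smult algebra_simps smult_diff_right)
    have le: "degree h \<le> degree g"
      unfolding h_def using 3 by (intro degree_add_le) (auto intro: order_trans[OF degree_smult_le])
    have "coeff h (degree g) = 0" by (simp add: h_def flip: 3)
    then have "degree h < degree g" using le h
      by (metis le_neq_implies_less leading_coeff_0_iff)
    then have "degree h + CHAR('a) \<le> d" using dvd_imp[OF g h W] assms by blast
    then show ?thesis using h unfolding h_def by blast
  qed
qed

text \<open>Since \<open>(x - c)^p = x^p - c^p\<close>, a monomial in \<open>x^p\<close> is constant
  to order p at every \<open>c\<close>. Row operations with such monomials therefore look like
  scalar ones up to that order.\<close>

lemma power_dvd_monom_diff_const:
  fixes a c :: "'a :: idom"
  assumes "prime CHAR('a)" "CHAR('a) dvd n"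
  shows "[:-c, 1:] ^ CHAR('a) dvd monom a n - [:poly (monom a n) c:]"
proof -
  let ?p = "CHAR('a)" and ?X = "[:0, 1 :: 'a:]"
  obtain k where n: "n = ?p * k" using assms(2) by auto
  have "([:-c, 1:] + [:c:]) ^ ?p = [:-c, 1:] ^ ?p + [:c:] ^ ?p"
    by (rule freshmans_dream) (use assms in simp_all)
  then have "?X ^ ?p - [:c:] ^ ?p = [:-c, 1:] ^ ?p" by simp
  moreover have "?X ^ ?p - [:c:] ^ ?p dvd (?X ^ ?p) ^ k - ([:c:] ^ ?p) ^ k"
    by (subst power_diff_sumr2) simp
  moreover have "monom a n - [:poly (monom a n) c:] = smult a ((?X ^ ?p) ^ k - ([:c:] ^ ?p) ^ k)"
    by (simp add: n poly_monom monom_altdef smult_diff_right power_mult poly_const_pow)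
  ultimately show ?thesis by (metis dvd_smult)
qed

lemma degree_diff_monom_less:
  fixes f g :: "'a :: field poly"
  assumes "g \<noteq> 0" "f \<noteq> 0" "degree g \<le> degree f"
  defines "r \<equiv> f - monom (lead_coeff f / lead_coeff g) (degree f - degree g) * g"
  shows "r = 0 \<or> degree r < degree f"
proof -
  let ?m = "monom (lead_coeff f / lead_coeff g) (degree f - degree g)"
  have deg: "degree (?m * g) = degree f"
    using assms by (simp add: degree_mult_eq degree_monom_eq monom_eq_0_iff)
  have "lead_coeff (?m * g) = lead_coeff f"
    using assms(1) by (simp only: lead_coeff_mult lead_coeff_monom) simp
  then have "coeff r (degree f) = 0" by (simp add: r_def deg)
  moreover have "degree r \<le> degree f" unfolding r_def by (intro degree_diff_le) (simp_all add: deg)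
  ultimately show ?thesis by (metis le_neq_implies_less leading_coeff_0_iff)
qed

section \<open>Pairs of polynomials over a discrete valuation ring\<close>

lemma dvr_facts:
  assumes "dvr_with_residue_field t \<iota> \<rho>"
  shows "unital_ring_hom \<iota>" "unital_ring_hom \<rho>" "\<rho> a = 0 \<longleftrightarrow> t dvd a" "\<rho> (\<iota> c) = c"
    "t \<noteq> 0" "a \<noteq> 0 \<Longrightarrow> \<exists>u n. u dvd 1 \<and> a = u * t ^ n"
  using assms by (auto simp: dvr_with_residue_field_def uniformizer_def irreducible_def)

text \<open>Inclusion and reduction are ring homomorphisms in opposite directions, so the same
  integers vanish on both sides.\<close>

lemma dvr_CHAR_eq:
  fixes t :: "'a :: idom" and \<rho> :: "'a \<Rightarrow> 'k :: field"
  assumes "dvr_with_residue_field t \<iota> \<rho>"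
  shows "CHAR('a) = CHAR('k)"
proof -
  note \<iota> = unital_ring_hom_simps(4,8)[OF dvr_facts(1)[OF assms]]
  note \<rho> = unital_ring_hom_simps(4,8)[OF dvr_facts(2)[OF assms]]
  have "of_nat n = (0 :: 'a) \<longleftrightarrow> of_nat n = (0 :: 'k)" for n
    using \<iota>(1) \<iota>(2)[of n] \<rho>(1) \<rho>(2)[of n] by auto
  then have "CHAR('a) dvd n \<longleftrightarrow> CHAR('k) dvd n" for n
    by (simp only: of_nat_eq_0_iff_char_dvd)
  then show ?thesis by (metis dvd_antisym dvd_refl)
qed

text \<open>The smaller of the two powers of \<open>t\<close> is pulled out. Combinations over the
  ring thereby acquire nontrivial reductions.\<close>

lemma dvr_primitive_pair:
  fixes a b :: "'a :: idom"
  assumes dvr: "dvr_with_residue_field t \<iota> \<rho>" and "a \<noteq> 0 \<or> b \<noteq> 0"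
  shows "\<exists>s a' b'. s \<noteq> 0 \<and> a = s * a' \<and> b = s * b' \<and> \<not> (t dvd a' \<and> t dvd b')"
proof -
  note d = dvr_facts[OF dvr]
  have unit: "\<not> t dvd u" if "u dvd 1" for u
    using that d(3)[of u] unital_ring_hom_simps[OF d(2)]
    by (metis dvdE mult_zero_left zero_neq_one)
  have *: "\<exists>s a' b'. s \<noteq> 0 \<and> a = s * a' \<and> b = s * b' \<and> \<not> t dvd a'"
    if asm: "a = u * t ^ m" "u dvd 1" "t ^ m dvd b" for a b u m
  proof -
    obtain b' where "b = t ^ m * b'" using asm(3) by auto
    then show ?thesis using asm unit d(5)
      by (intro exI[of _ "t ^ m"] exI[of _ u] exI[of _ b']) (simp add: mult.commute)
  qed
  show ?thesis
  proof (cases "a = 0 \<or> b = 0")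
    case True
    then show ?thesis using assms(2) * d(6)[of a] d(6)[of b] by (metis dvd_0_right)
  next
    case False
    obtain u m v n where "a = u * t ^ m" "u dvd 1" "b = v * t ^ n" "v dvd 1"
      using False d(6) by metis
    then show ?thesis
      using *[of a u m b] *[of b v n a] le_imp_power_dvd[of m n t] le_imp_power_dvd[of n m t]
      by (metis dvd_mult linorder_le_cases)
  qed
qed

lemma dvr_map_poly_eq_0:
  assumes "dvr_with_residue_field t \<iota> \<rho>" "map_poly \<rho> F = 0"
  shows "\<exists>F'. F = smult t F'"
proof -
  have "\<rho> (coeff F n) = 0" for n
    using assms(2) dvr_facts(2)[OF assms(1)] unital_ring_hom_simps(4) by (metis coeff_0 coeff_map_poly)
  then have "[:t:] dvd F" unfolding const_poly_dvd_iff using dvr_facts(3)[OF assms(1)] by blast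
  then show ?thesis by (auto elim!: dvdE)
qed

text \<open>
  The pair is modified by transformations that change its Wronskian by a nonzero scalar only:
  subtracting from one polynomial a multiple of the other by a constant of the derivation, which
  lowers the degree of a reduction, and dividing a polynomial with zero reduction by \<open>t\<close>, which
  lowers the valuation of the Wronskian. When no step applies, the two reductions have degrees that
  differ modulo the characteristic, and their Wronskian is nonzero.
\<close>
lemma dvr_adapted_pair:
  fixes t :: "'a :: idom" and \<rho> :: "'a \<Rightarrow> 'k :: field" and F G W\<^sub>0 :: "'a poly"
  assumes dvr: "dvr_with_residue_field t \<iota> \<rho>"
    and prime: "prime CHAR('k)"
    and W\<^sub>0: "map_poly \<rho> W\<^sub>0 \<noteq> 0"
    and e: "\<And>i. i \<in> I \<Longrightarrow> e i \<le> CHAR('k)"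
    and W: "wronskian F G = smult w W\<^sub>0" "w \<noteq> 0"
    and comb: "\<And>i. i \<in> I \<Longrightarrow> \<exists>\<alpha> \<beta>. \<not> (t dvd \<alpha> \<and> t dvd \<beta>) \<and>
                  [:- P i, 1:] ^ e i dvd smult \<alpha> F + smult \<beta> G"
    and h: "\<exists>a b. pderiv a = 0 \<and> pderiv b = 0 \<and> h = a * map_poly \<rho> F + b * map_poly \<rho> G"
  shows "\<exists>f g c. f \<noteq> 0 \<and> g \<noteq> 0 \<and> of_nat (degree f) \<noteq> (of_nat (degree g) :: 'k) \<and>
           c \<noteq> 0 \<and> wronskian f g = smult c (map_poly \<rho> W\<^sub>0) \<and>
           (\<forall>i\<in>I. \<exists>\<alpha> \<beta>. (\<alpha> \<noteq> 0 \<or> \<beta> \<noteq> 0) \<and>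
              [:- \<rho> (P i), 1:] ^ e i dvd smult \<alpha> f + smult \<beta> g) \<and>
           (\<exists>a b. pderiv a = 0 \<and> pderiv b = 0 \<and> h = a * f + b * g)"
proof -
  note d = dvr_facts[OF dvr]
  note \<rho>s = unital_ring_hom_simps[OF d(2)] unital_ring_hom_simps[OF unital_ring_hom_map_poly[OF d(2)]]
    map_poly_hom_simps[OF d(2)]
  have char: "CHAR('a) = CHAR('k)" by (rule dvr_CHAR_eq[OF dvr])
  let ?r = "map_poly \<rho>"
  \<comment> \<open>\<open>v\<close> is the valuation of the scalar in front of
    \<open>W\<^sub>0\<close>. The combinations at the points stay primitive, and \<open>h\<close>
    stays in the span of the reductions over the constants of the derivation.\<close>
  define Inv where "Inv v F G \<longleftrightarrow>
      (\<exists>u. u dvd 1 \<and> wronskian F G = smult (u * t ^ v) W\<^sub>0) \<and>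
      (\<forall>i\<in>I. \<exists>\<alpha> \<beta>. \<not> (t dvd \<alpha> \<and> t dvd \<beta>) \<and> [:- P i, 1:] ^ e i dvd smult \<alpha> F + smult \<beta> G) \<and>
      (\<exists>a b. pderiv a = 0 \<and> pderiv b = 0 \<and> h = a * ?r F + b * ?r G)" for v F G
  have swap: "Inv v G F" if inv: "Inv v F G" for v F G
  proof -
    obtain u where "u dvd 1" "wronskian F G = smult (u * t ^ v) W\<^sub>0" using inv unfolding Inv_def by blast
    then have "- u dvd 1 \<and> wronskian G F = smult (- u * t ^ v) W\<^sub>0" by (simp add: wronskian_swap[of G F])
    then have "\<exists>u. u dvd 1 \<and> wronskian G F = smult (u * t ^ v) W\<^sub>0" by (rule exI)
    moreover have "\<exists>\<alpha> \<beta>. \<not> (t dvd \<alpha> \<and> t dvd \<beta>) \<and> [:- P i, 1:] ^ e i dvd smult \<alpha> G + smult \<beta> F"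
      if i: "i \<in> I" for i
    proof -
      obtain \<alpha> \<beta> where "\<not> (t dvd \<alpha> \<and> t dvd \<beta>)" "[:- P i, 1:] ^ e i dvd smult \<alpha> F + smult \<beta> G"
        using inv i unfolding Inv_def by blast
      then show ?thesis by (intro exI[of _ \<beta>] exI[of _ \<alpha>]) (auto simp: add.commute)
    qed
    moreover obtain a b where "pderiv a = 0" "pderiv b = 0" "h = a * ?r F + b * ?r G"
      using inv unfolding Inv_def by blast
    then have "\<exists>a b. pderiv a = 0 \<and> pderiv b = 0 \<and> h = a * ?r G + b * ?r F"
      by (intro exI[of _ b] exI[of _ a]) (simp add: add.commute)
    ultimately show ?thesis unfolding Inv_def by blast
  qed
  have subtract: "Inv v (F - monom c n * G) G" if inv: "Inv v F G" and n: "CHAR('k) dvd n" for v F G c n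
  proof -
    let ?q = "monom c n"
    have q: "pderiv ?q = 0" using n char by (simp add: pderiv_monom of_nat_eq_0_iff_char_dvd)
    have "wronskian (F - ?q * G) G = wronskian F G" by (rule wronskian_diff_mult[OF q])
    then have 1: "\<exists>u. u dvd 1 \<and> wronskian (F - ?q * G) G = smult (u * t ^ v) W\<^sub>0"
      using inv by (simp add: Inv_def)
    have 2: "\<exists>\<alpha> \<beta>. \<not> (t dvd \<alpha> \<and> t dvd \<beta>) \<and> [:- P i, 1:] ^ e i dvd smult \<alpha> (F - ?q * G) + smult \<beta> G"
      if "i \<in> I" for i
    proof -
      obtain \<alpha> \<beta> where ab: "\<not> (t dvd \<alpha> \<and> t dvd \<beta>)" "[:- P i, 1:] ^ e i dvd smult \<alpha> F + smult \<beta> G"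
        using inv \<open>i \<in> I\<close> unfolding Inv_def by blast
      \<comment> \<open>Up to order \<open>e i \<le> p\<close> at \<open>P i\<close> the monomial is
        its value there, so correcting \<open>\<beta>\<close> by a scalar restores the
        divisibility.\<close>
      have "[:- P i, 1:] ^ e i dvd ?q - [:poly ?q (P i):]"
        using power_dvd_monom_diff_const[of n "P i" c] prime n char e[OF \<open>i \<in> I\<close>]
        by (metis power_le_dvd)
      then have "[:- P i, 1:] ^ e i dvd smult \<alpha> F + smult \<beta> G - smult \<alpha> ((?q - [:poly ?q (P i):]) * G)"
        by (rule dvd_diff[OF ab(2) dvd_smult[OF dvd_mult2]])
      also have "smult \<alpha> F + smult \<beta> G - smult \<alpha> ((?q - [:poly ?q (P i):]) * G) =
          smult \<alpha> (F - ?q * G) + smult (\<alpha> * poly ?q (P i) + \<beta>) G"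
        by (simp add: algebra_simps smult_diff_right smult_add_left)
      finally have "[:- P i, 1:] ^ e i dvd smult \<alpha> (F - ?q * G) + smult (\<alpha> * poly ?q (P i) + \<beta>) G" .
      moreover have "\<not> (t dvd \<alpha> \<and> t dvd \<alpha> * poly ?q (P i) + \<beta>)"
        using ab(1) dvd_add_right_iff[of t "\<alpha> * poly ?q (P i)" \<beta>] by (metis dvd_mult2)
      ultimately show ?thesis by blast
    qed
    obtain a b where ab: "pderiv a = 0" "pderiv b = 0" "h = a * ?r F + b * ?r G"
      using inv unfolding Inv_def by blast
    have "pderiv (?r ?q) = 0" using q by (simp add: pderiv_map_poly[OF d(2)])
    then have "pderiv (b + a * ?r ?q) = 0" using ab by (simp add: pderiv_add pderiv_mult)
    moreover have "h = a * ?r (F - ?q * G) + (b + a * ?r ?q) * ?r G"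
      by (simp add: ab(3) \<rho>s algebra_simps)
    ultimately show ?thesis using 1 2 ab(1) unfolding Inv_def by blast
  qed
  have divide: "\<exists>v' G'. v' < v \<and> Inv v' F G'" if inv: "Inv v F G" and G: "?r G = 0" for v F G
  proof -
    obtain G' where G': "G = smult t G'" using dvr_map_poly_eq_0[OF dvr G] by blast
    obtain u where u: "u dvd 1" "wronskian F G = smult (u * t ^ v) W\<^sub>0" using inv unfolding Inv_def by blast
    \<comment> \<open>At \<open>v = 0\<close> the reduced Wronskian is a nonzero multiple of that of
      \<open>W\<^sub>0\<close>, but it vanishes together with the reduction of
      \<open>G\<close>.\<close>
    have "v \<noteq> 0"
    proof
      assume "v = 0"
      then have "smult (\<rho> u) (?r W\<^sub>0) = 0"
        using arg_cong[OF u(2), of ?r] G by (simp add: map_poly_wronskian[OF d(2)] \<rho>s)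
      moreover have "\<rho> u \<noteq> 0" using u(1) \<rho>s by (metis dvdE mult_zero_left zero_neq_one)
      ultimately show False using W\<^sub>0 by simp
    qed
    then obtain v' where v: "v = Suc v'" by (cases v) auto
    have "smult t (wronskian F G') = smult t (smult (u * t ^ v') W\<^sub>0)"
      using u(2) by (simp add: G' wronskian_smult_right v mult_ac)
    then have "smult t (wronskian F G' - smult (u * t ^ v') W\<^sub>0) = 0"
      by (simp only: smult_diff_right) simp
    then have "wronskian F G' = smult (u * t ^ v') W\<^sub>0" using d(5) by simp
    then have 1: "\<exists>u. u dvd 1 \<and> wronskian F G' = smult (u * t ^ v') W\<^sub>0" using u(1) by blast
    have 2: "\<exists>\<alpha> \<beta>. \<not> (t dvd \<alpha> \<and> t dvd \<beta>) \<and> [:- P i, 1:] ^ e i dvd smult \<alpha> F + smult \<beta> G'"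
      if "i \<in> I" for i
    proof -
      obtain \<alpha> \<beta> where ab: "\<not> (t dvd \<alpha> \<and> t dvd \<beta>)" "[:- P i, 1:] ^ e i dvd smult \<alpha> F + smult \<beta> G"
        using inv \<open>i \<in> I\<close> unfolding Inv_def by blast
      show ?thesis
      \<comment> \<open>Either \<open>\<alpha>\<close> keeps the combination primitive and
        \<open>\<beta>\<close> absorbs the factor \<open>t\<close>, or \<open>t\<close> cancels from
        the whole combination and \<open>\<beta>\<close> keeps it primitive.\<close>
      proof (cases "t dvd \<alpha>")
        case False
        then show ?thesis using ab by (intro exI[of _ \<alpha>] exI[of _ "\<beta> * t"]) (simp add: G')
      next
        case True
        then obtain \<alpha>' where \<alpha>: "\<alpha> = t * \<alpha>'" by auto
        have "smult \<alpha> F + smult \<beta> G = smult t (smult \<alpha>' F + smult \<beta> G')"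
          by (simp add: \<alpha> G' smult_add_right mult.commute)
        then show ?thesis using ab True d(5) by (metis power_dvd_smult_iff)
      qed
    qed
    obtain a b where ab: "pderiv a = 0" "pderiv b = 0" "h = a * ?r F + b * ?r G"
      using inv unfolding Inv_def by blast
    then have "h = a * ?r F + 0 * ?r G'" using G by simp
    then have "Inv v' F G'" using 1 2 ab(1) unfolding Inv_def by (metis pderiv_0)
    then show ?thesis using v by blast
  qed
  let ?good = "\<lambda>F G. ?r F \<noteq> 0 \<and> ?r G \<noteq> 0 \<and> of_nat (degree (?r F)) \<noteq> (of_nat (degree (?r G)) :: 'k)"
  \<comment> \<open>Nested descent: divisions by \<open>t\<close> lower \<open>v\<close>, and
    between them row operations lower the sum of the degrees of the reductions.\<close>
  have "\<exists>v F G. Inv v F G \<and> ?good F G" if "Inv v F G" for v F G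
    using that
  proof (induction v arbitrary: F G rule: less_induct)
    case (less v)
    note outer = less.IH
    have zero: "\<exists>v F G. Inv v F G \<and> ?good F G" if "Inv v F G" "?r F = 0 \<or> ?r G = 0" for F G
      using divide[OF that(1)] divide[OF swap[OF that(1)]] that(2) outer by blast
    from less.prems show ?case
    proof (induction "degree (?r F) + degree (?r G)" arbitrary: F G rule: less_induct)
      case (less F G)
      have reduce: "\<exists>v F G. Inv v F G \<and> ?good F G"
        if inv: "Inv v F1 G1" and nz: "?r F1 \<noteq> 0" "?r G1 \<noteq> 0"
          and eq: "of_nat (degree (?r F1)) = (of_nat (degree (?r G1)) :: 'k)"
          and le: "degree (?r G1) \<le> degree (?r F1)"
          and same: "degree (?r F1) + degree (?r G1) = degree (?r F) + degree (?r G)" for F1 G1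
      proof -
        \<comment> \<open>Degrees equal modulo p make the exponent of the leading quotient divisible
          by p, so the row operation is allowed; \<open>\<iota>\<close> lifts its coefficient to the
          ring.\<close>
        let ?n = "degree (?r F1) - degree (?r G1)"
        let ?c = "lead_coeff (?r F1) / lead_coeff (?r G1)"
        define F2 where "F2 = F1 - monom (\<iota> ?c) ?n * G1"
        have "of_nat ?n = (0 :: 'k)" using eq le by (simp add: of_nat_diff)
        then have inv2: "Inv v F2 G1"
          unfolding F2_def by (intro subtract[OF inv]) (simp add: of_nat_eq_0_iff_char_dvd)
        have "?r F2 = ?r F1 - monom ?c ?n * ?r G1" by (simp add: F2_def \<rho>s d(4))
        then have "?r F2 = 0 \<or> degree (?r F2) < degree (?r F1)"
          using degree_diff_monom_less[OF nz(2,1) le] by simp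
        then show ?thesis
        proof
          assume "?r F2 = 0"
          then show ?thesis using zero[OF inv2] by blast
        next
          assume "degree (?r F2) < degree (?r F1)"
          then show ?thesis using less.hyps[of F2 G1] inv2 same by auto
        qed
      qed
      show ?case
      proof (cases "?good F G \<or> ?r F = 0 \<or> ?r G = 0")
        case True
        then show ?thesis using zero[OF less.prems] less.prems by blast
      next
        case False
        then show ?thesis
          using reduce[OF less.prems] reduce[OF swap[OF less.prems]]
          by (cases "degree (?r G) \<le> degree (?r F)") auto
      qed
    qed
  qed
  moreover obtain u v where "u dvd 1" "w = u * t ^ v" using d(6)[OF W(2)] by blast
  then have "Inv v F G" unfolding Inv_def using W(1) comb h by blast
  ultimately obtain v F G where inv: "Inv v F G" and good: "?good F G" by blast
  obtain u where u: "u dvd 1" "wronskian F G = smult (u * t ^ v) W\<^sub>0" using inv unfolding Inv_def by blast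
  have eq: "wronskian (?r F) (?r G) = smult (\<rho> (u * t ^ v)) (?r W\<^sub>0)"
    using arg_cong[OF u(2), of ?r] by (simp add: map_poly_wronskian[OF d(2)] \<rho>s)
  \<comment> \<open>Degrees that differ modulo p give a nonzero Wronskian, hence a scalar that is
    nonzero in the residue field.\<close>
  moreover have "wronskian (?r F) (?r G) \<noteq> 0" using wronskian_degree(1) good by blast
  ultimately have "\<rho> (u * t ^ v) \<noteq> 0" by auto
  moreover have "\<exists>\<alpha> \<beta>. (\<alpha> \<noteq> 0 \<or> \<beta> \<noteq> 0) \<and>
              [:- \<rho> (P i), 1:] ^ e i dvd smult \<alpha> (?r F) + smult \<beta> (?r G)" if i: "i \<in> I" for i
  proof -
    obtain \<alpha> \<beta> where ab: "\<not> (t dvd \<alpha> \<and> t dvd \<beta>)" "[:- P i, 1:] ^ e i dvd smult \<alpha> F + smult \<beta> G"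
      using inv i unfolding Inv_def by blast
    then obtain z where z: "smult \<alpha> F + smult \<beta> G = [:- P i, 1:] ^ e i * z" by auto
    have "smult (\<rho> \<alpha>) (?r F) + smult (\<rho> \<beta>) (?r G) = [:- \<rho> (P i), 1:] ^ e i * ?r z"
      using arg_cong[OF z, of ?r] by (simp add: \<rho>s)
    then show ?thesis using ab(1) d(3) by (metis dvd_triv_left)
  qed
  moreover have "\<exists>a b. pderiv a = 0 \<and> pderiv b = 0 \<and> h = a * ?r F + b * ?r G"
    using inv unfolding Inv_def by (elim conjE)
  ultimately show ?thesis using good eq
    by - (rule exI[of _ "?r F"], rule exI[of _ "?r G"], rule exI[of _ "\<rho> (u * t ^ v)"], blast)
qed

section \<open>Maps with prescribed ramification\<close>

text \<open>Infinity maps to \<open>[1 : 0]\<close>, whose fibre is cut out by \<open>g\<close>. In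
  the coordinate \<open>1/x\<close>, \<open>g\<close> is a power times its reflection, which has
  nonzero constant term.\<close>

lemma ram_index_Infty:
  fixes f g :: "'a :: field poly"
  assumes "degree g < degree f" "g \<noteq> 0"
  shows "ram_index (degree f) f g Infty = degree f - degree g"
proof -
  let ?D = "degree f" and ?k = "degree f - degree g"
  have coeff: "coeff (at_infinity ?D q) n = (if n \<le> ?D then coeff q (?D - n) else 0)" for q :: "'a poly" and n
  proof -
    have "coeff (at_infinity ?D q) n = (\<Sum>i\<le>?D. if i = ?D - n \<and> n \<le> ?D then coeff q i else 0)"
      unfolding at_infinity_def coeff_sum by (intro sum.cong) auto
    then show ?thesis by (auto simp: sum.delta)
  qed
  have g: "at_infinity ?D g = monom 1 ?k * reflect_poly g"
  proof (rule poly_eqI)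
    fix n
    consider "?D < n" | "n < ?k" | "?k \<le> n" "n \<le> ?D" by linarith
    then show "coeff (at_infinity ?D g) n = coeff (monom 1 ?k * reflect_poly g) n"
    proof cases
      case 3
      then have "?D - n = degree g - (n - ?k)" using assms(1) by linarith
      then show ?thesis using 3 assms(1) unfolding coeff by (auto simp: coeff_monom_mult coeff_reflect_poly)
    qed (use assms(1) in \<open>auto simp: coeff coeff_monom_mult coeff_reflect_poly coeff_eq_0\<close>)
  qed
  have "f \<noteq> 0" using assms(1) by auto
  have "poly (at_infinity ?D f) 0 = lead_coeff f" by (simp add: poly_0_coeff_0 coeff)
  moreover have "poly (at_infinity ?D g) 0 = 0" using assms(1) by (simp add: poly_0_coeff_0 coeff coeff_eq_0)
  moreover have "order 0 (monom 1 ?k * reflect_poly g) = ?k"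
  proof -
    have "order 0 (reflect_poly g) = 0" using assms(2) by (intro order_0I) simp
    moreover have "order 0 (monom (1 :: 'a) ?k) = ?k"
      using order_power_n_n[of "0 :: 'a" ?k] by (simp add: monom_altdef)
    ultimately show ?thesis using assms(2) by (simp add: order_mult monom_eq_0_iff)
  qed
  then have "order 0 (at_infinity ?D g) = ?k" by (simp only: g)
  ultimately show ?thesis using \<open>f \<noteq> 0\<close>
    by (simp add: Let_def order_smult flip: smult_minus_left)
qed

text \<open>A nonconstant common factor would have a root over the algebraically closed field.
  Taking \<open>degree f\<close> as the degree excludes a base point at infinity.\<close>

lemma separable_p1_map:
  fixes f g :: "'a :: alg_closed_field poly"
  assumes "CHAR('a) > 0" "wronskian f g \<noteq> 0" "degree g < degree f"
    and zeros: "\<And>c. poly f c \<noteq> 0 \<or> poly g c \<noteq> 0"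
  shows "p1_map (degree f) f g \<and> separable_map f g \<and> ram_index (degree f) f g Infty = degree f - degree g"
proof -
  have nz: "f \<noteq> 0" "g \<noteq> 0" using assms(2) by auto
  have "coprime f g"
  proof (rule coprimeI)
    fix u assume u: "u dvd f" "u dvd g"
    have "degree u = 0"
    proof (rule ccontr)
      assume "degree u \<noteq> 0"
      then obtain c where "poly u c = 0" using alg_closed_imp_poly_has_root by blast
      then have "[:-c, 1:] dvd u" by (simp add: poly_eq_0_iff_dvd)
      then show False using zeros[of c] u by (metis dvd_trans poly_eq_0_iff_dvd)
    qed
    moreover have "u \<noteq> 0" using u nz by auto
    ultimately show "u dvd 1" by (simp add: is_unit_iff_degree)
  qed
  then show ?thesis
    using assms(3) nz separable_map_if_wronskian[OF assms(1,2)] ram_index_Infty[OF assms(3) nz(2)]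
    by (simp add: p1_map_def)
qed

text \<open>The exponent is the smaller of the two orders at \<open>c\<close>.\<close>

lemma factor_out_common_zero:
  fixes f g :: "'a :: idom poly"
  assumes "f \<noteq> 0" "g \<noteq> 0"
  shows "\<exists>b f\<^sub>1 g\<^sub>1. f = [:-c, 1:] ^ b * f\<^sub>1 \<and> g = [:-c, 1:] ^ b * g\<^sub>1 \<and> (poly f\<^sub>1 c \<noteq> 0 \<or> poly g\<^sub>1 c \<noteq> 0)"
proof -
  let ?l = "[:-c, 1:]"
  have *: "\<exists>f\<^sub>1 g\<^sub>1. f = ?l ^ order c f * f\<^sub>1 \<and> g = ?l ^ order c f * g\<^sub>1 \<and> poly f\<^sub>1 c \<noteq> 0"
    if "f \<noteq> 0" "g \<noteq> 0" "order c f \<le> order c g" for f g :: "'a poly"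
  proof -
    obtain f\<^sub>1 where "f = ?l ^ order c f * f\<^sub>1" "\<not> ?l dvd f\<^sub>1" using order_decomp[OF \<open>f \<noteq> 0\<close>] by blast
    moreover have "?l ^ order c f dvd g" using that by (simp add: order_divides)
    then obtain g\<^sub>1 where "g = ?l ^ order c f * g\<^sub>1" by blast
    ultimately show ?thesis by (auto simp: poly_eq_0_iff_dvd)
  qed
  show ?thesis
    using *[of f g] *[of g f] assms by (cases "order c f \<le> order c g") (blast, metis linorder_le_cases)
qed

text \<open>Riemann-Hurwitz as a degree count: the local factors already have total degree
  \<open>2 d - 2\<close>, the most that the Wronskian can have, so the cofactor is constant.\<close>

lemma wronskian_of_ramification:
  fixes F G :: "'a :: idom poly"
  defines "y \<equiv> \<lambda>c. smult (poly G c) F - smult (poly F c) G"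
  assumes "finite I" "inj_on P I" "degree F \<le> d" "degree G \<le> d"
    and e: "\<And>i. i \<in> I \<Longrightarrow> order (P i) (y (P i)) = e i"
    and nz: "\<And>i. i \<in> I \<Longrightarrow> poly F (P i) \<noteq> 0 \<or> poly G (P i) \<noteq> 0" "\<And>i. i \<in> I \<Longrightarrow> y (P i) \<noteq> 0"
    and sum: "(\<Sum>i\<in>I. e i - 1) = 2 * d - 2" "d > 0"
    and tame: "i\<^sub>0 \<in> I" "of_nat (e i\<^sub>0) \<noteq> (0 :: 'a)"
  shows "\<exists>w. w \<noteq> 0 \<and> wronskian F G = smult w (\<Prod>i\<in>I. [:- P i, 1:] ^ (e i - 1))"
proof -
  let ?W = "\<Prod>i\<in>I. [:- P i, 1:] ^ (e i - 1)"
  have W: "wronskian F G \<noteq> 0"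
    using wronskian_fibre[of F "P i\<^sub>0" G] nz[OF tame(1)] tame(2) e[OF tame(1)] by (simp add: y_def)
  have "[:- P i, 1:] ^ (e i - 1) dvd wronskian F G" if i: "i \<in> I" for i
  proof -
    have "[:- P i, 1:] ^ e i dvd smult (poly G (P i)) F + smult (- poly F (P i)) G"
      using order_1[of "P i" "y (P i)"] e[OF i] by (simp add: y_def)
    then show ?thesis using power_dvd_wronskian_of_comb(1)[of "poly G (P i)" "- poly F (P i)"] nz(1)[OF i] by auto
  qed
  then have "?W dvd wronskian F G" by (rule prod_linear_powers_dvd[OF assms(2,3)])
  then obtain q where q: "wronskian F G = ?W * q" by (elim dvdE)
  have "degree (wronskian F G) \<le> 2 * d - 2"
  proof -
    have "degree (wronskian F G) \<le> d + d - 1" using wronskian_top(2)[OF assms(4,5)] sum(2) by simp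
    \<comment> \<open>The coefficient carries the factor \<open>d - d\<close>.\<close>
    moreover have "coeff (wronskian F G) (d + d - 1) = 0" using wronskian_top(1)[OF assms(4,5)] sum(2) by simp
    ultimately have "degree (wronskian F G) \<noteq> d + d - 1" using W by (metis leading_coeff_0_iff)
    then show ?thesis using \<open>degree (wronskian F G) \<le> d + d - 1\<close> by simp
  qed
  moreover have "degree (wronskian F G) = (2 * d - 2) + degree q"
    using W sum(1) unfolding q by (subst degree_mult_eq) (auto simp: degree_prod_linear_powers)
  ultimately have "degree q = 0" by linarith
  then obtain w where "q = [:w:]" using degree_0_id by metis
  then show ?thesis using q W by (intro exI[of _ w]) auto
qed

theorem theorem6p1:
  fixes t :: "'a :: idom"
    and \<iota> :: "'k :: alg_closed_field \<Rightarrow> 'a"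
    and \<rho> :: "'a \<Rightarrow> 'k"
    and p n d :: nat
    and e :: "nat \<Rightarrow> nat"
    and P :: "nat \<Rightarrow> 'a"
    and F G :: "'a poly"
  assumes "CHAR('k) = p" and "p > 2"
    and "dvr_with_residue_field t \<iota> \<rho>"
    and "\<forall>i\<in>{1..n}. 0 < e i \<and> e i < p"
    and "(\<Sum>i = 1..n. (int (e i) - 1)) = 2 * int d - 2"
    and "linear_series \<rho> d F G"
    and "p1_map d (map_poly to_fract F) (map_poly to_fract G)"
    and "separable_map (map_poly to_fract F) (map_poly to_fract G)"
    and "tamely_ramified d (map_poly to_fract F) (map_poly to_fract G)"
    and "inj_on P {1..n}"
    and "\<forall>i\<in>{1..n}.
           ram_index d (map_poly to_fract F) (map_poly to_fract G) (Fin (to_fract (P i))) = e i"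
    and "\<not> separable_map (map_poly \<rho> F) (map_poly \<rho> G)"
  shows
    "(inj_on (\<lambda>i. \<rho> (P i)) {1..n} \<longrightarrow>
       (\<exists>m. p \<le> m \<and> m \<le> d \<and>
         (\<exists>(f :: 'k poly) g. p1_map (d + m - 1) f g \<and> separable_map f g \<and>
            (\<forall>i\<in>{1..n}. ram_index (d + m - 1) f g (Fin (\<rho> (P i))) = e i) \<and>
            ram_index (d + m - 1) f g Infty = 2 * m - 1)))
     \<and>
     (\<forall>j\<in>{1..n}. \<forall>j'\<in>{1..n}.
        j \<noteq> j' \<and> \<rho> (P j) = \<rho> (P j') \<and> e j + e j' < p \<and>
        inj_on (\<lambda>i. \<rho> (P i)) ({1..n} - {j'}) \<longrightarrow>
       (\<exists>m b. p \<le> m \<and> m \<le> d \<and> real b < (real (e j) + real (e j') - 1) / 2 \<and>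
         (\<exists>(f :: 'k poly) g. p1_map (d + m - 1 - b) f g \<and> separable_map f g \<and>
            (\<forall>i\<in>{1..n} - {j, j'}.
               ram_index (d + m - 1 - b) f g (Fin (\<rho> (P i))) = e i) \<and>
            ram_index (d + m - 1 - b) f g (Fin (\<rho> (P j))) = e j + e j' - 2 * b - 1 \<and>
            ram_index (d + m - 1 - b) f g Infty = 2 * m - 1)))"
proof -
  let ?r = "map_poly \<rho>" and ?I = "{1..n}" and ?f = "map_poly to_fract :: 'a poly \<Rightarrow> 'a fract poly"
  note dvr = assms(3)
  note d = dvr_facts[OF dvr]
  note \<rho>s = unital_ring_hom_simps[OF d(2)] unital_ring_hom_simps[OF unital_ring_hom_map_poly[OF d(2)]]
    map_poly_hom_simps[OF d(2)]
  note fr = unital_ring_hom_simps[OF unital_ring_hom_map_poly[OF unital_ring_hom_to_fract]]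
    map_poly_hom_simps[OF unital_ring_hom_to_fract]
  have char: "CHAR('k) > 0" and p: "CHAR('k) = p" using assms(1,2) by auto
  have prime: "prime CHAR('k)" using char by (rule prime_CHAR_semidom)
  have charA: "CHAR('a) = p" using dvr_CHAR_eq[OF dvr] p by simp
  have e: "0 < e i" "e i < p" if "i \<in> ?I" for i using assms(4) that by auto
  have deg: "degree F \<le> d" "degree G \<le> d"
    and indep: "\<forall>a b. smult a (?r F) + smult b (?r G) = 0 \<longrightarrow> a = 0 \<and> b = 0"
    using assms(6) unfolding linear_series_def by auto

  \<comment> \<open>Special fibre: a section of small degree\<close>
  have "degree (?r F) \<le> d" "degree (?r G) \<le> d"
    using deg by (auto intro: order_trans[OF map_poly_degree_leq])
  \<comment> \<open>Contrapositive of the separability criterion.\<close>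
  moreover have "wronskian (?r F) (?r G) = 0"
    using separable_map_if_wronskian[OF char] assms(12) by blast
  ultimately obtain a\<^sub>0 b\<^sub>0 where h: "smult a\<^sub>0 (?r F) + smult b\<^sub>0 (?r G) \<noteq> 0"
      "degree (smult a\<^sub>0 (?r F) + smult b\<^sub>0 (?r G)) + p \<le> d"
    using small_degree_comb[OF indep] p by metis
  \<comment> \<open>This section is carried through all modifications of the pair, to bound the
    smaller degree at the end.\<close>
  define h where "h = smult a\<^sub>0 (?r F) + smult b\<^sub>0 (?r G)"
  have d_pos: "p \<le> d" "2 < d" using h(2) assms(2) by auto
  have "int (e i - 1) = int (e i) - 1" if "i \<in> ?I" for i using e(1)[OF that] by simp
  then have "(\<Sum>i\<in>?I. int (e i - 1)) = (\<Sum>i\<in>?I. int (e i) - 1)"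
    by (intro sum.cong) auto
  then have "int (\<Sum>i\<in>?I. e i - 1) = int (2 * d - 2)" using assms(5) d_pos by (simp add: of_nat_diff)
  then have sum: "(\<Sum>i\<in>?I. e i - 1) = 2 * d - 2" by (simp only: of_nat_eq_iff)
  \<comment> \<open>Without points the sum would be 0, but \<open>2 d - 2 > 0\<close>. Point 1
    serves as the tame point that makes the Wronskian nonzero.\<close>
  then have "1 \<in> ?I" using d_pos by (cases "n = 0") auto

  \<comment> \<open>Generic fibre: ramification and Wronskian over the ring\<close>
  have indepA: "\<alpha> = 0 \<and> \<beta> = 0" if zero: "smult \<alpha> F + smult \<beta> G = 0" for \<alpha> \<beta>
  proof (rule ccontr)
    assume "\<not> (\<alpha> = 0 \<and> \<beta> = 0)"
    \<comment> \<open>After removing the common factor a nontrivial relation would survive reduction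
      modulo \<open>t\<close>.\<close>
    then obtain s \<alpha>' \<beta>' where s: "s \<noteq> 0" "\<alpha> = s * \<alpha>'" "\<beta> = s * \<beta>'" "\<not> (t dvd \<alpha>' \<and> t dvd \<beta>')"
      using dvr_primitive_pair[OF dvr, of \<alpha> \<beta>] by blast
    have "smult s (smult \<alpha>' F + smult \<beta>' G) = 0" using zero s by (simp add: smult_add_right)
    then have "smult \<alpha>' F + smult \<beta>' G = 0" using s(1) by simp
    from arg_cong[OF this, of ?r] show False using indep s(4) d(3) by (auto simp: \<rho>s)
  qed
  define y where "y c = smult (poly G c) F - smult (poly F c) G" for c
  have nz: "poly F (P i) \<noteq> 0 \<or> poly G (P i) \<noteq> 0" for i
  proof -
    have "coprime (?f F) (?f G)" using assms(7) by (simp add: p1_map_def)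
    then show ?thesis using coprime_poly_0[of "?f F" "?f G" "to_fract (P i)"] by (simp add: fr)
  qed
  have y: "y (P i) \<noteq> 0" for i
    using indepA[of "poly G (P i)" "- poly F (P i)"] nz[of i] by (auto simp: y_def)
  have order_y: "order (P i) (y (P i)) = e i" if "i \<in> ?I" for i
  proof -
    have "?f (y (P i)) = smult (poly (?f G) (to_fract (P i))) (?f F) - smult (poly (?f F) (to_fract (P i))) (?f G)"
      by (simp add: y_def fr)
    then have "order (to_fract (P i)) (?f (y (P i))) = e i" using assms(11) that by simp
    then show ?thesis using order_map_poly[OF unital_ring_hom_to_fract _ y] by (simp add: inj_def)
  qed
  define W\<^sub>0 where "W\<^sub>0 = (\<Prod>i\<in>?I. [:- P i, 1:] ^ (e i - 1))"
  have "of_nat (e 1) \<noteq> (0 :: 'a)"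
    using e[OF \<open>1 \<in> ?I\<close>] charA by (auto simp: of_nat_eq_0_iff_char_dvd dest: dvd_imp_le)
  then obtain w where w: "w \<noteq> 0" "wronskian F G = smult w W\<^sub>0"
    using wronskian_of_ramification[OF finite_atLeastAtMost assms(10) deg, of e 1] order_y nz y sum d_pos
      \<open>1 \<in> ?I\<close> unfolding W\<^sub>0_def y_def by auto
  have rW: "?r W\<^sub>0 = (\<Prod>i\<in>?I. [:- \<rho> (P i), 1:] ^ (e i - 1))"
    unfolding W\<^sub>0_def unital_ring_hom_prod[OF unital_ring_hom_map_poly[OF d(2)]]
    by (simp add: \<rho>s)
  have rW_nz: "?r W\<^sub>0 \<noteq> 0" unfolding rW by auto

  \<comment> \<open>The adapted pair over the residue field\<close>
  have "\<exists>\<alpha> \<beta>. \<not> (t dvd \<alpha> \<and> t dvd \<beta>) \<and> [:- P i, 1:] ^ e i dvd smult \<alpha> F + smult \<beta> G"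
    if i: "i \<in> ?I" for i
  proof -
    obtain s \<alpha> \<beta> where s: "s \<noteq> 0" "poly G (P i) = s * \<alpha>" "- poly F (P i) = s * \<beta>" "\<not> (t dvd \<alpha> \<and> t dvd \<beta>)"
      using dvr_primitive_pair[OF dvr, of "poly G (P i)" "- poly F (P i)"] nz[of i] by auto
    have "y (P i) = smult (poly G (P i)) F + smult (- poly F (P i)) G" by (simp add: y_def)
    also have "\<dots> = smult s (smult \<alpha> F + smult \<beta> G)" unfolding s(2,3) by (simp add: smult_add_right)
    finally show ?thesis
      using order_1[of "P i" "y (P i)"] order_y[OF i] s(1,4) by (metis power_dvd_smult_iff)
  qed
  moreover have "h = [:a\<^sub>0:] * ?r F + [:b\<^sub>0:] * ?r G" by (simp add: h_def)
  then have "\<exists>a b. pderiv a = 0 \<and> pderiv b = 0 \<and> h = a * ?r F + b * ?r G"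
    by (metis pderiv_singleton)
  ultimately obtain f\<^sub>0 g\<^sub>0 c\<^sub>0 where fg0: "f\<^sub>0 \<noteq> 0" "g\<^sub>0 \<noteq> 0" "of_nat (degree f\<^sub>0) \<noteq> (of_nat (degree g\<^sub>0) :: 'k)"
      "c\<^sub>0 \<noteq> 0" "wronskian f\<^sub>0 g\<^sub>0 = smult c\<^sub>0 (?r W\<^sub>0)"
      "\<forall>i\<in>?I. \<exists>\<alpha> \<beta>. (\<alpha> \<noteq> 0 \<or> \<beta> \<noteq> 0) \<and> [:- \<rho> (P i), 1:] ^ e i dvd smult \<alpha> f\<^sub>0 + smult \<beta> g\<^sub>0"
      "\<exists>a b. pderiv a = 0 \<and> pderiv b = 0 \<and> h = a * f\<^sub>0 + b * g\<^sub>0"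
    using dvr_adapted_pair[OF dvr prime rW_nz _ w(2,1), of ?I e P h] e(2) p by (metis less_imp_le)
  \<comment> \<open>The pair is ordered so that \<open>g\<close> has the smaller degree; a swap
    changes the sign of the Wronskian.\<close>
  define sw where "sw \<longleftrightarrow> degree f\<^sub>0 < degree g\<^sub>0"
  define f g c where "f = (if sw then g\<^sub>0 else f\<^sub>0)" and "g = (if sw then f\<^sub>0 else g\<^sub>0)"
    and "c = (if sw then - c\<^sub>0 else c\<^sub>0)"
  have "degree f\<^sub>0 \<noteq> degree g\<^sub>0" using fg0(3) by auto
  then have lt: "degree g < degree f" by (auto simp: f_def g_def sw_def)
  have fg: "f \<noteq> 0" "g \<noteq> 0" "of_nat (degree f) \<noteq> (of_nat (degree g) :: 'k)" "c \<noteq> 0"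
    using fg0(1-4) by (auto simp: f_def g_def c_def)
  have W: "wronskian f g = smult c (?r W\<^sub>0)"
    using fg0(5) by (auto simp: f_def g_def c_def wronskian_swap[of g\<^sub>0 f\<^sub>0])
  have comb: "\<exists>\<alpha> \<beta>. (\<alpha> \<noteq> 0 \<or> \<beta> \<noteq> 0) \<and> [:- \<rho> (P i), 1:] ^ e i dvd smult \<alpha> f + smult \<beta> g"
    if i: "i \<in> ?I" for i
  proof -
    obtain \<alpha> \<beta> where "\<alpha> \<noteq> 0 \<or> \<beta> \<noteq> 0" "[:- \<rho> (P i), 1:] ^ e i dvd smult \<alpha> f\<^sub>0 + smult \<beta> g\<^sub>0"
      using fg0(6) i by blast
    then show ?thesis
      by (intro exI[of _ "if sw then \<beta> else \<alpha>"] exI[of _ "if sw then \<alpha> else \<beta>"])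
        (auto simp: f_def g_def add.commute)
  qed
  have "\<exists>a b. pderiv a = 0 \<and> pderiv b = 0 \<and> h = a * f + b * g"
  proof -
    obtain a b where "pderiv a = 0" "pderiv b = 0" "h = a * f\<^sub>0 + b * g\<^sub>0"
      using fg0(7) by blast
    then show ?thesis
      by (intro exI[of _ "if sw then b else a"] exI[of _ "if sw then a else b"])
        (auto simp: f_def g_def add.commute)
  qed
  \<comment> \<open>\<open>h\<close> is a combination of \<open>f\<close> and \<open>g\<close> over
    the constants, where leading terms cannot cancel.\<close>
  then have "degree g \<le> degree h"
    using degree_le_of_comb[OF fg(3) lt] h(1) unfolding h_def by metis
  then have deg_g: "degree g + p \<le> d" using h(2) unfolding h_def by linarith
  have W_nz: "wronskian f g \<noteq> 0" using W rW_nz fg(4) by simp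
  have "degree f + degree g - 1 = 2 * d - 2"
    using wronskian_degree(2)[OF fg(1-3)] W fg(4) sum by (simp add: rW degree_prod_linear_powers)
  then have deg_f: "degree f + degree g = 2 * d - 1" using d_pos by linarith
  \<comment> \<open>From \<open>deg f + deg g = 2 d - 1\<close> this gives degree
    \<open>d + m - 1\<close> for \<open>f\<close> and index \<open>2 m - 1\<close> at
    infinity.\<close>
  define m where "m = d - degree g"
  have m: "p \<le> m" "m \<le> d" "degree f = d + m - 1" "degree f - degree g = 2 * m - 1"
    using deg_f deg_g d_pos by (auto simp: m_def)

  \<comment> \<open>Vanishing orders and base points\<close>
  have order_W: "order x (wronskian f g) = (\<Sum>i\<in>{i\<in>?I. \<rho> (P i) = x}. e i - 1)" for x
    using fg(4) by (simp add: W rW order_smult order_prod_linear_powers)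
  have order_W_single: "order (\<rho> (P i)) (wronskian f g) = e i - 1"
    if "i \<in> ?I" "\<And>i'. i' \<in> ?I \<Longrightarrow> \<rho> (P i') = \<rho> (P i) \<Longrightarrow> i' = i" for i
  proof -
    have "{i'\<in>?I. \<rho> (P i') = \<rho> (P i)} = {i}" using that by blast
    then show ?thesis by (simp add: order_W)
  qed
  \<comment> \<open>A base point would raise the order of the Wronskian there to at least
    \<open>e i\<close>.\<close>
  have no_zero: "poly f (\<rho> (P i)) \<noteq> 0 \<or> poly g (\<rho> (P i)) \<noteq> 0"
    if i: "i \<in> ?I" and single: "order (\<rho> (P i)) (wronskian f g) = e i - 1" for i
  proof (rule ccontr)
    assume zero: "\<not> ?thesis"
    obtain \<alpha> \<beta> where "\<alpha> \<noteq> 0 \<or> \<beta> \<noteq> 0" "[:- \<rho> (P i), 1:] ^ e i dvd smult \<alpha> f + smult \<beta> g"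
      using comb[OF i] by blast
    then have "[:- \<rho> (P i), 1:] ^ e i dvd wronskian f g"
      using power_dvd_wronskian_of_comb(2) zero by blast
    then have "e i \<le> e i - 1" using W_nz single by (simp add: order_divides)
    then show False using e(1)[OF i] by simp
  qed
  have common_zero: "\<exists>i\<in>?I. x = \<rho> (P i)" if "poly f x = 0" "poly g x = 0" for x
  proof -
    have "poly (wronskian f g) x = 0" using that by (simp add: wronskian_def)
    then have "order x (wronskian f g) \<noteq> 0" using W_nz by (simp add: order_root)
    then have "{i\<in>?I. \<rho> (P i) = x} \<noteq> {}" unfolding order_W by (metis sum.empty)
    then show ?thesis by blast
  qed

  \<comment> \<open>Distinct limits\<close>
  have part1: "p1_map (d + m - 1) f g \<and> separable_map f g \<and>
      (\<forall>i\<in>?I. ram_index (d + m - 1) f g (Fin (\<rho> (P i))) = e i) \<and>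
      ram_index (d + m - 1) f g Infty = 2 * m - 1"
    if inj: "inj_on (\<lambda>i. \<rho> (P i)) ?I"
  proof -
    have single: "order (\<rho> (P i)) (wronskian f g) = e i - 1" if i: "i \<in> ?I" for i
      by (rule order_W_single[OF i]) (use inj_onD[OF inj] i in blast)
    have zeros: "poly f x \<noteq> 0 \<or> poly g x \<noteq> 0" for x
      using common_zero[of x] no_zero single by blast
    have "ram_index (degree f) f g (Fin (\<rho> (P i))) = e i" if "i \<in> ?I" for i
      using ram_index_wronskian[OF zeros W_nz, of "\<rho> (P i)"] single[OF that] e[OF that] p by simp
    then show ?thesis
      using separable_p1_map[OF char W_nz lt zeros, unfolded m(4)] unfolding m(3) by blast
  qed

  \<comment> \<open>Two colliding limits\<close>
  have part2: "\<exists>b f\<^sub>1 g\<^sub>1. real b < (real (e j) + real (e j') - 1) / 2 \<and>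
      p1_map (d + m - 1 - b) f\<^sub>1 g\<^sub>1 \<and> separable_map f\<^sub>1 g\<^sub>1 \<and>
      (\<forall>i\<in>?I - {j, j'}. ram_index (d + m - 1 - b) f\<^sub>1 g\<^sub>1 (Fin (\<rho> (P i))) = e i) \<and>
      ram_index (d + m - 1 - b) f\<^sub>1 g\<^sub>1 (Fin (\<rho> (P j))) = e j + e j' - 2 * b - 1 \<and>
      ram_index (d + m - 1 - b) f\<^sub>1 g\<^sub>1 Infty = 2 * m - 1"
    if j: "j \<in> ?I" "j' \<in> ?I" "j \<noteq> j'" "\<rho> (P j) = \<rho> (P j')" "e j + e j' < p"
      and inj: "inj_on (\<lambda>i. \<rho> (P i)) (?I - {j'})" for j j'
  proof -
    let ?Q = "\<rho> (P j)"
    have inj': "i = i'" if "\<rho> (P i) = \<rho> (P i')" "i \<in> ?I - {j'}" "i' \<in> ?I - {j'}" for i i'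
      by (rule inj_onD[OF inj that])
    have neq: "\<rho> (P i) \<noteq> ?Q" if "i \<in> ?I - {j, j'}" for i
      using inj'[of i j] that j by auto
    have single: "order (\<rho> (P i)) (wronskian f g) = e i - 1" if i: "i \<in> ?I - {j, j'}" for i
    proof (rule order_W_single)
      fix i' assume i': "i' \<in> ?I" "\<rho> (P i') = \<rho> (P i)"
      have "i' \<noteq> j'" using neq[OF i] i'(2) j(4) by auto
      then show "i' = i" using inj'[of i' i] i i' by auto
    qed (use i in simp)
    have "{i\<in>?I. \<rho> (P i) = ?Q} = {j, j'}" using j neq by fastforce
    then have order_Q: "order ?Q (wronskian f g) = (e j - 1) + (e j' - 1)" using j(3) by (simp add: order_W)
    \<comment> \<open>The common factor at the collision point lowers the degree by \<open>b\<close>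
      and the order of the Wronskian by \<open>2 b\<close>.\<close>
    obtain b f\<^sub>1 g\<^sub>1 where f1: "f = [:- ?Q, 1:] ^ b * f\<^sub>1" and g1: "g = [:- ?Q, 1:] ^ b * g\<^sub>1"
      and Q: "poly f\<^sub>1 ?Q \<noteq> 0 \<or> poly g\<^sub>1 ?Q \<noteq> 0"
      using factor_out_common_zero[OF fg(1,2)] by blast
    let ?l = "[:- ?Q, 1:] ^ b"
    have W1: "wronskian f g = ?l ^ 2 * wronskian f\<^sub>1 g\<^sub>1" unfolding f1 g1 by (rule wronskian_mult)
    then have W1_nz: "wronskian f\<^sub>1 g\<^sub>1 \<noteq> 0" and nz1: "f\<^sub>1 \<noteq> 0" "g\<^sub>1 \<noteq> 0" using W_nz fg f1 g1 by auto
    have order_W1: "order x (wronskian f g) = 2 * order x ?l + order x (wronskian f\<^sub>1 g\<^sub>1)" for x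
      using W_nz unfolding W1 power2_eq_square by (simp add: order_mult)
    have "order ?Q (wronskian f\<^sub>1 g\<^sub>1) + 2 * b = (e j - 1) + (e j' - 1)"
      using order_W1[of ?Q] order_Q by (simp add: order_power_n_n)
    \<comment> \<open>The successor is the future ramification index; being positive, it also yields
      the strict bound on \<open>b\<close>.\<close>
    then have ord: "Suc (order ?Q (wronskian f\<^sub>1 g\<^sub>1)) + 2 * b + 1 = e j + e j'"
      using e(1)[OF j(1)] e(1)[OF j(2)] by linarith
    have ord_other: "order x (wronskian f\<^sub>1 g\<^sub>1) = order x (wronskian f g)" if "x \<noteq> ?Q" for x
    proof -
      have "order x ?l = 0" using that by (intro order_0I) auto
      then show ?thesis using order_W1[of x] by simp
    qed
    have degs: "degree f = b + degree f\<^sub>1" "degree g = b + degree g\<^sub>1"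
      using nz1 by (simp_all add: f1 g1 degree_mult_eq degree_power_eq)
    \<comment> \<open>At the collision point common zeros were divided out; elsewhere only isolated
      limits are candidates.\<close>
    have zeros: "poly f\<^sub>1 x \<noteq> 0 \<or> poly g\<^sub>1 x \<noteq> 0" for x
    proof (rule ccontr)
      assume "\<not> ?thesis"
      then have zero: "poly f\<^sub>1 x = 0" "poly g\<^sub>1 x = 0" by auto
      then have fg_zero: "poly f x = 0" "poly g x = 0" by (simp_all add: f1 g1)
      then obtain i where i: "i \<in> ?I" "x = \<rho> (P i)" using common_zero by blast
      have "i \<in> ?I - {j, j'}" using zero Q i j(4) by auto
      then show False using no_zero[OF i(1)] single fg_zero i by blast
    qed
    have D: "degree f\<^sub>1 = d + m - 1 - b" "degree f\<^sub>1 - degree g\<^sub>1 = 2 * m - 1" "degree g\<^sub>1 < degree f\<^sub>1"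
      using degs m lt by linarith+
    have "ram_index (degree f\<^sub>1) f\<^sub>1 g\<^sub>1 (Fin (\<rho> (P i))) = e i" if i: "i \<in> ?I - {j, j'}" for i
      using ram_index_wronskian[OF zeros W1_nz, of "\<rho> (P i)"] ord_other[OF neq[OF i]] single[OF i]
        e[of i] i p by simp
    moreover have "ram_index (degree f\<^sub>1) f\<^sub>1 g\<^sub>1 (Fin ?Q) = e j + e j' - 2 * b - 1"
      using ram_index_wronskian[OF zeros W1_nz, of ?Q] ord j(5) p by simp
    moreover have "real (2 * b + 1) < real (e j + e j')" using ord by (simp only: of_nat_less_iff)
    then have "real b < (real (e j) + real (e j') - 1) / 2" by simp
    ultimately show ?thesis
      using separable_p1_map[OF char W1_nz D(3) zeros, unfolded D(2)] unfolding D(1) by blast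
  qed
  show ?thesis using part1 part2 m(1,2) by (intro conjI impI ballI) (blast, meson)
qed

end
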